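(* Let $(A,\alpha_A)$ and $(H,\alpha_H)$ be Hom-vector spaces with antisymmetric brackets $[\cdot,\cdot]$ on $A$ and on $H$, co-antisymmetric maps $\delta_A:A\to A\otimes A$, $\delta_H:H\to H\otimes H$, and linear maps $\triangleright:H\otimes A\to A$, $\triangleleft:H\otimes A\to H$, $\sigma:H\otimes H\to A$, $\theta:A\otimes A\to H$, $\phi:A\to H\otimes A$, $\psi:H\to H\otimes A$, $P:A\to H\otimes H$, $Q:H\to A\otimes A$, such that $(A,H)$ is both a cocycle cross product system and a cycle cross coproduct system. Then $E=A\oplus H$ with $\alpha_E=\alpha_A\oplus\alpha_H$, the bracket $$[(a,x),(b,y)]=\big([a,b]+x\triangleright b-y\triangleright a+\sigma(x,y),\ [x,y]+x\triangleleft b-y\triangleleft a+\theta(a,b)\big)$$ and the cobracket $$\delta_E(a)=\delta_A(a)+\phi(a)-\tau\phi(a)+P(a),\qquad \delta_E(x)=\delta_H(x)+\psi(x)-\tau\psi(x)+Q(x)$$ is a Hom-Lie bialgebra if and only if the following hold for all $a,b\in A$, $x,y\in H$: (TBB5) $\delta_A(x\triangleright a)+Q(x\triangleleft a)=\alpha_H(x)\triangleright a_1\otimes\alpha_A(a_2)+\alpha_A(a_1)\otimes\alpha_H(x)\triangleright a_2+x_{(0)}\triangleright\alpha_A(a)\otimes\alpha_A(x_{(1)})-\alpha_A(x_{(1)})\otimes x_{(0)}\triangleright\alpha_A(a)+[Q(x),\alpha_A(a)]+\sigma(\alpha_H(x),a_{(-1)})\otimes\alpha_A(a_{(0)})-\alpha_A(a_{(0)})\otimes\sigma(\alpha_H(x),a_{(-1)})$;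 (TBB6) $\delta_H(x\triangleleft a)+P(x\triangleright a)=\alpha_H(x_1)\otimes x_2\triangleleft\alpha_A(a)+x_1\triangleleft\alpha_A(a)\otimes\alpha_H(x_2)+\alpha_H(a_{(-1)})\otimes\alpha_H(x)\triangleleft a_{(0)}-\alpha_H(x)\triangleleft a_{(0)}\otimes\alpha_H(a_{(-1)})+[\alpha_H(x),P(a)]+\alpha_H(x_{(0)})\otimes\theta(x_{(1)},\alpha_A(a))-\theta(x_{(1)},\alpha_A(a))\otimes\alpha_H(x_{(0)})$; (TBB7) $\phi([a,b])+\psi(\theta(a,b))=\alpha_H(a_{(-1)})\otimes[a_{(0)},\alpha_A(b)]+\alpha_H(b_{(-1)})\otimes[\alpha_A(a),b_{(0)}]+a_{(-1)}\triangleleft\alpha_A(b)\otimes\alpha_A(a_{(0)})-b_{(-1)}\triangleleft\alpha_A(a)\otimes\alpha_A(b_{(0)})+\theta(\alpha_A(a),b_1)\otimes\alpha_A(b_2)+\theta(a_1,\alpha_A(b))\otimes\alpha_A(a_2)+\alpha_H(a_{[1]})\otimes a_{[2]}\triangleright\alpha_A(b)-\alpha_H(b_{[1]})\otimes b_{[2]}\triangleright\alpha_A(a)$; (TBB8) $\psi([x,y])+\phi(\sigma(x,y))=[\alpha_H(x),y_{(0)}]\otimes\alpha_A(y_{(1)})+[x_{(0)},\alpha_H(y)]\otimes\alpha_A(x_{(1)})+\alpha_H(y_{(0)})\otimes\alpha_H(x)\triangleright y_{(1)}-\alpha_H(x_{(0)})\otimes\alpha_H(y)\triangleright x_{(1)}+\alpha_H(x_1)\otimes\sigma(x_2,\alpha_H(y))+\alpha_H(y_1)\otimes\sigma(\alpha_H(x),y_2)+\alpha_H(x)\triangleleft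 y_{\langle1\rangle}\otimes\alpha_A(y_{\langle2\rangle})-\alpha_H(y)\triangleleft x_{\langle1\rangle}\otimes\alpha_A(x_{\langle2\rangle})$; (TLB1) $\delta_H(\theta(a,b))+P([a,b])=\alpha_H(a_{(-1)})\otimes\theta(a_{(0)},\alpha_A(b))+\alpha_H(b_{(-1)})\otimes\theta(\alpha_A(a),b_{(0)})-\theta(\alpha_A(a),b_{(0)})\otimes\alpha_H(b_{(-1)})-\theta(a_{(0)},\alpha_A(b))\otimes\alpha_H(a_{(-1)})+\alpha_H(a_{[1]})\otimes a_{[2]}\triangleleft\alpha_A(b)+a_{[1]}\triangleleft\alpha_A(b)\otimes\alpha_H(a_{[2]})-b_{[1]}\triangleleft\alpha_A(a)\otimes\alpha_H(b_{[2]})-\alpha_H(b_{[1]})\otimes b_{[2]}\triangleleft\alpha_A(a)$; (TLB2) $\delta_A(\sigma(x,y))+Q([x,y])=\sigma(x_{(0)},\alpha_H(y))\otimes\alpha_A(x_{(1)})+\sigma(\alpha_H(x),y_{(0)})\otimes\alpha_A(y_{(1)})-\alpha_A(y_{(1)})\otimes\sigma(\alpha_H(x),y_{(0)})-\alpha_A(x_{(1)})\otimes\sigma(x_{(0)},\alpha_H(y))+\alpha_H(x)\triangleright y_{\langle1\rangle}\otimes\alpha_A(y_{\langle2\rangle})+\alpha_A(y_{\langle1\rangle})\otimes\alpha_H(x)\triangleright y_{\langle2\rangle}-\alpha_A(x_{\langle1\rangle})\otimes\alpha_H(y)\triangleright x_{\langle2\rangle}-\alpha_H(y)\triangleright x_{\langle1\rangle}\otimes\alpha_A(x_{\langle2\rangle})$;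 (TLB3) $\delta_A([a,b])+Q(\theta(a,b))=[\alpha_A(a),\delta_A(b)]+[\delta_A(a),\alpha_A(b)]-b_{(-1)}\triangleright\alpha_A(a)\otimes\alpha_A(b_{(0)})-\alpha_A(a_{(0)})\otimes a_{(-1)}\triangleright\alpha_A(b)+a_{(-1)}\triangleright\alpha_A(b)\otimes\alpha_A(a_{(0)})+\alpha_A(b_{(0)})\otimes b_{(-1)}\triangleright\alpha_A(a)$; (TLB4) $\delta_H([x,y])+P(\sigma(x,y))=[\delta_H(x),\alpha_H(y)]+[\alpha_H(x),\delta_H(y)]-\alpha_H(x_{(0)})\otimes\alpha_H(y)\triangleleft x_{(1)}-\alpha_H(x)\triangleleft y_{(1)}\otimes\alpha_H(y_{(0)})+\alpha_H(y_{(0)})\otimes\alpha_H(x)\triangleleft y_{(1)}+\alpha_H(y)\triangleleft x_{(1)}\otimes\alpha_H(x_{(0)})$; (TYD) $\phi(x\triangleright a)+\psi(x\triangleleft a)=[\alpha_H(x),a_{(-1)}]\otimes\alpha_A(a_{(0)})+\alpha_H(a_{(-1)})\otimes\alpha_H(x)\triangleright a_{(0)}+\alpha_H(x_1)\otimes x_2\triangleright\alpha_A(a)+\alpha_H(x_{(0)})\otimes[x_{(1)},\alpha_A(a)]+x_{(0)}\triangleleft\alpha_A(a)\otimes\alpha_A(x_{(1)})+\alpha_H(x)\triangleleft a_1\otimes\alpha_A(a_2)+\alpha_H(a_{[1]})\otimes\sigma(\alpha_H(x),a_{[2]})+\theta(x_{\langle1\rangle},\alpha_A(a))\otimes\alp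ha_A(x_{\langle2\rangle})$.
   Context: All vector spaces are over an algebraically closed field $k$ of characteristic different from 2 and 3. A Hom-vector space $(V,\alpha_V)$ is a vector space with a linear map $\alpha_V:V\to V$. $\tau(x\otimes y)=y\otimes x$, $\tau_{12}(x\otimes y\otimes z)=y\otimes x\otimes z$, $\tau_{23}(x\otimes y\otimes z)=x\otimes z\otimes y$. A Hom-Lie algebra $(H,[\cdot,\cdot],\alpha_H)$: skew-symmetric bilinear bracket with $[\alpha_H(x),[y,z]]+[\alpha_H(y),[z,x]]+[\alpha_H(z),[x,y]]=0$ (no multiplicativity of $\alpha_H$ is required). A Hom-Lie coalgebra $(H,\delta,\alpha_H)$: $\delta=-\tau\delta$ and $(\alpha_H\otimes\delta)\delta=(\delta\otimes\alpha_H)\delta+\tau_{12}(\alpha_H\otimes\delta)\delta$. A Hom-Lie bialgebra is both at once, with $\delta([x,y])=[\alpha_H(x),\delta(y)]+[\delta(x),\alpha_H(y)]$. Here and below $[z,u_1\otimes u_2]:=[z,u_1]\otimes\alpha(u_2)+\alpha(u_1)\otimes[z,u_2]$ and $[u_1\otimes u_2,z]:=[u_1,z]\otimes\alpha(u_2)+\alpha(u_1)\otimes[u_2,z]$, with $\alpha$ the structure map of the space in question. Sigma notation (summation suppressed): $\delta(x)=x_1\otimes x_2$, $\phi(a)=a_{(-1)}\otimes a_{(0)}\in H\otimes A$, $\psi(x)=x_{(0)}\otimes x_{(1)}\in H\otimes A$, $P(a)=a_{[1]}\otimes a_{[2]}\in H\otimes H$, $Q(x)=x_{\langle1\rangle}\otimes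 x_{\langle2\rangle}\in A\otimes A$. A map $f$ into $X\otimes X$ is co-antisymmetric if $f=-\tau f$. $\circlearrowleft$ denotes the sum over the three cyclic permutations of the displayed arguments; for $u$ in a triple tensor product, $\mathrm{Cyc}(u)=u+\tau_{12}\tau_{23}u+\tau_{23}\tau_{12}u$. $(A,H)$ is a cocycle cross product system if: (1) $A$ is a $\theta$-Hom-Lie algebra: $[\cdot,\cdot]$ on $A$ and $\theta$ are antisymmetric, $\circlearrowleft_{a,b,c}\theta(a,b)\triangleleft\alpha_A(c)=\circlearrowleft_{a,b,c}\theta(\alpha_A(a),[b,c])$ and $\circlearrowleft_{a,b,c}[[a,b],\alpha_A(c)]=-\circlearrowleft_{a,b,c}\theta(a,b)\triangleright\alpha_A(c)$; (2) $H$ is a $\sigma$-Hom-Lie algebra: $[\cdot,\cdot]$ on $H$ and $\sigma$ are antisymmetric, $\circlearrowleft_{x,y,z}\alpha_H(x)\triangleright\sigma(y,z)=\circlearrowleft_{x,y,z}\sigma([x,y],\alpha_H(z))$ and $\circlearrowleft_{x,y,z}[[x,y],\alpha_H(z)]=\circlearrowleft_{x,y,z}\alpha_H(x)\triangleleft\sigma(y,z)$; (3) for all $a,b\in A$, $x,y\in H$: (TM1) $[x,y]\triangleright\alpha_A(a)+[\sigma(x,y),\alpha_A(a)]=\alpha_H(x)\triangleright(y\triangleright a)-\alpha_H(y)\triangleright(x\triangleright a)+\sigma(\alpha_H(x),y\triangleleft a)+\sigma(x\triangleleft a,\alpha_H(y))$; (TM2) $\alpha_H(x)\triangleleft[a,b]+[\alpha_H(x),\theta(a,b)]=(x\triangleleft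 a)\triangleleft\alpha_A(b)-(x\triangleleft b)\triangleleft\alpha_A(a)+\theta(x\triangleright a,\alpha_A(b))+\theta(\alpha_A(a),x\triangleright b)$; (TBB1) $\alpha_H(x)\triangleright[a,b]+\sigma(\alpha_H(x),\theta(a,b))=[x\triangleright a,\alpha_A(b)]+[\alpha_A(a),x\triangleright b]+(x\triangleleft a)\triangleright\alpha_A(b)-(x\triangleleft b)\triangleright\alpha_A(a)$; (TBB2) $[x,y]\triangleleft\alpha_A(a)+\theta(\sigma(x,y),\alpha_A(a))=[\alpha_H(x),y\triangleleft a]+[x\triangleleft a,\alpha_H(y)]+\alpha_H(x)\triangleleft(y\triangleright a)-\alpha_H(y)\triangleleft(x\triangleright a)$. $(A,H)$ is a cycle cross coproduct system if: (1) $A$ is a $Q$-Hom-Lie coalgebra: $\delta_A$ and $Q$ are co-antisymmetric, $\mathrm{Cyc}(Q(x_{(0)})\otimes\alpha_A(x_{(1)}))=\mathrm{Cyc}(\alpha_A(x_{\langle1\rangle})\otimes\delta_A(x_{\langle2\rangle}))$ and $\mathrm{Cyc}(\delta_A(a_1)\otimes\alpha_A(a_2))=-\mathrm{Cyc}(Q(a_{(-1)})\otimes\alpha_A(a_{(0)}))$; (2) $H$ is a $P$-Hom-Lie coalgebra: $\delta_H$ and $P$ are co-antisymmetric, $\mathrm{Cyc}(\alpha_H(a_{(-1)})\otimes P(a_{(0)}))=\mathrm{Cyc}(\delta_H(a_{[1]})\otimes\alpha_H(a_{[2]}))$ and $\mathrm{Cyc}(\delta_H(x_1)\otimes\alpha_H(x_2))=\mathrm{Cyc}(\alpha_H(x_{(0)})\otimes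 P(x_{(1)}))$; (3) for all $a\in A$, $x\in H$: (TM3) $\delta_H(a_{(-1)})\otimes\alpha_A(a_{(0)})+P(a_1)\otimes\alpha_A(a_2)=\alpha_H(a_{(-1)})\otimes\phi(a_{(0)})-\tau_{12}(\alpha_H(a_{(-1)})\otimes\phi(a_{(0)}))+\alpha_H(a_{[1]})\otimes\psi(a_{[2]})+\tau_{23}(\psi(a_{[1]})\otimes\alpha_H(a_{[2]}))$; (TM4) $\alpha_H(x_{(0)})\otimes\delta_A(x_{(1)})+\alpha_H(x_1)\otimes Q(x_2)=\psi(x_{(0)})\otimes\alpha_A(x_{(1)})-\tau_{23}(\psi(x_{(0)})\otimes\alpha_A(x_{(1)}))+\phi(x_{\langle1\rangle})\otimes\alpha_A(x_{\langle2\rangle})+\tau_{12}(\alpha_A(x_{\langle1\rangle})\otimes\phi(x_{\langle2\rangle}))$; (TBB3) $\alpha_H(a_{(-1)})\otimes\delta_A(a_{(0)})+\alpha_H(a_{[1]})\otimes Q(a_{[2]})=\phi(a_1)\otimes\alpha_A(a_2)+\tau_{12}(\alpha_A(a_1)\otimes\phi(a_2))+\psi(a_{(-1)})\otimes\alpha_A(a_{(0)})-\tau_{23}(\psi(a_{(-1)})\otimes\alpha_A(a_{(0)}))$; (TBB4) $\delta_H(x_{(0)})\otimes\alpha_A(x_{(1)})+P(x_{\langle1\rangle})\otimes\alpha_A(x_{\langle2\rangle})=\alpha_H(x_1)\otimes\psi(x_2)+\tau_{23}(\psi(x_1)\otimes\alpha_H(x_2))+\alpha_H(x_{(0)})\otimes\phi(x_{(1)})-\tau_{12}(\alpha_H(x_{(0)})\otimes\phi(x_{(1)}))$.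 *)

theory Defs
  imports
    "HOL-Analysis.Product_Vector"
    "HOL-Library.Function_Algebras"
    "HOL-Computational_Algebra.Polynomial"
begin

section \<open>Tensor products over a field\<close>

text \<open>
  Vector spaces are types of class \<open>ab_group_add\<close> with an explicit scalar multiplication, as in
  \<^theory>\<open>HOL.Vector_Spaces\<close>.  The library has no tensor product of such spaces.  We realise
  the tensor product of \<open>V\<close> and \<open>W\<close> inside the dual of the space of bilinear forms on
  \<open>V \<times> W\<close>: the pure tensor of \<open>v\<close> and \<open>w\<close> is evaluation at \<open>(v, w)\<close>, and the tensor product
  is the span of the pure tensors.  Functionals are extended by \<open>0\<close> to functions that are not
  bilinear, so that equality of tensors is plain equality.  The lemmas \<open>tensor_universal\<close>,
  \<open>tensor_unique\<close> and their versions for three factors show that this is the tensor product,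
  for spaces of arbitrary dimension.
\<close>

definition bilinear_map ::
  "('k::field \<Rightarrow> 'u::ab_group_add \<Rightarrow> 'u) \<Rightarrow> ('k \<Rightarrow> 'v::ab_group_add \<Rightarrow> 'v)
    \<Rightarrow> ('k \<Rightarrow> 't::ab_group_add \<Rightarrow> 't) \<Rightarrow> ('u \<Rightarrow> 'v \<Rightarrow> 't) \<Rightarrow> bool" where
  "bilinear_map s1 s2 s f \<longleftrightarrow>
    (\<forall>v. Vector_Spaces.linear s1 s (\<lambda>u. f u v)) \<and> (\<forall>u. Vector_Spaces.linear s2 s (\<lambda>v. f u v))"

definition trilinear_map ::
  "('k::field \<Rightarrow> 'u::ab_group_add \<Rightarrow> 'u) \<Rightarrow> ('k \<Rightarrow> 'v::ab_group_add \<Rightarrow> 'v)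
    \<Rightarrow> ('k \<Rightarrow> 'w::ab_group_add \<Rightarrow> 'w) \<Rightarrow> ('k \<Rightarrow> 't::ab_group_add \<Rightarrow> 't)
    \<Rightarrow> ('u \<Rightarrow> 'v \<Rightarrow> 'w \<Rightarrow> 't) \<Rightarrow> bool" where
  "trilinear_map s1 s2 s3 s f \<longleftrightarrow>
    (\<forall>v w. Vector_Spaces.linear s1 s (\<lambda>u. f u v w)) \<and>
    (\<forall>u w. Vector_Spaces.linear s2 s (\<lambda>v. f u v w)) \<and>
    (\<forall>u v. Vector_Spaces.linear s3 s (\<lambda>w. f u v w))"

type_synonym ('k, 'u, 'v) tensor2 = "('u \<Rightarrow> 'v \<Rightarrow> 'k) \<Rightarrow> 'k"
type_synonym ('k, 'u, 'v, 'w) tensor3 = "('u \<Rightarrow> 'v \<Rightarrow> 'w \<Rightarrow> 'k) \<Rightarrow> 'k"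

definition fun_scale :: "'k::field \<Rightarrow> ('x \<Rightarrow> 'k) \<Rightarrow> 'x \<Rightarrow> 'k" where
  "fun_scale c t = (\<lambda>B. c * t B)"

definition tens ::
  "('k::field \<Rightarrow> 'u::ab_group_add \<Rightarrow> 'u) \<Rightarrow> ('k \<Rightarrow> 'v::ab_group_add \<Rightarrow> 'v)
    \<Rightarrow> 'u \<Rightarrow> 'v \<Rightarrow> ('k, 'u, 'v) tensor2" where
  "tens s1 s2 u v = (\<lambda>B. if bilinear_map s1 s2 (*) B then B u v else 0)"

definition tens3 ::
  "('k::field \<Rightarrow> 'u::ab_group_add \<Rightarrow> 'u) \<Rightarrow> ('k \<Rightarrow> 'v::ab_group_add \<Rightarrow> 'v)
    \<Rightarrow> ('k \<Rightarrow> 'w::ab_group_add \<Rightarrow> 'w) \<Rightarrow> 'u \<Rightarrow> 'v \<Rightarrow> 'w \<Rightarrow> ('k, 'u, 'v, 'w) tensor3" where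
  "tens3 s1 s2 s3 u v w = (\<lambda>B. if trilinear_map s1 s2 s3 (*) B then B u v w else 0)"

definition tensor_space ::
  "('k::field \<Rightarrow> 'u::ab_group_add \<Rightarrow> 'u) \<Rightarrow> ('k \<Rightarrow> 'v::ab_group_add \<Rightarrow> 'v)
    \<Rightarrow> ('k, 'u, 'v) tensor2 set" where
  "tensor_space s1 s2 = module.span fun_scale {tens s1 s2 u v | u v. True}"

definition tensor_space3 ::
  "('k::field \<Rightarrow> 'u::ab_group_add \<Rightarrow> 'u) \<Rightarrow> ('k \<Rightarrow> 'v::ab_group_add \<Rightarrow> 'v)
    \<Rightarrow> ('k \<Rightarrow> 'w::ab_group_add \<Rightarrow> 'w) \<Rightarrow> ('k, 'u, 'v, 'w) tensor3 set" where
  "tensor_space3 s1 s2 s3 = module.span fun_scale {tens3 s1 s2 s3 u v w | u v w. True}"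

text \<open>
  Sigma notation: \<open>t \<star> (\<lambda>u v. f u v)\<close> is \<open>f t\<^sub>1 t\<^sub>2\<close> (summation suppressed) for \<open>t = t\<^sub>1 \<otimes> t\<^sub>2\<close>.
  Since elements of a tensor product are functionals, this is the linear map induced by a
  bilinear map \<open>f\<close> into another such space (lemma \<open>sweedler_tens\<close>).
\<close>

definition sweedler ::
  "('k::field, 'u, 'v) tensor2 \<Rightarrow> ('u \<Rightarrow> 'v \<Rightarrow> 'x \<Rightarrow> 'k) \<Rightarrow> 'x \<Rightarrow> 'k" (infixl "\<star>" 75) where
  "t \<star> f = (\<lambda>B. t (\<lambda>u v. f u v B))"

definition tau :: "('k, 'u, 'v) tensor2 \<Rightarrow> ('k, 'v, 'u) tensor2" where
  "tau t = (\<lambda>B. t (\<lambda>u v. B v u))"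

definition tau12 :: "('k, 'u, 'v, 'w) tensor3 \<Rightarrow> ('k, 'v, 'u, 'w) tensor3" where
  "tau12 t = (\<lambda>B. t (\<lambda>u v w. B v u w))"

definition tau23 :: "('k, 'u, 'v, 'w) tensor3 \<Rightarrow> ('k, 'u, 'w, 'v) tensor3" where
  "tau23 t = (\<lambda>B. t (\<lambda>u v w. B u w v))"

definition Cyc :: "('k::field, 'v, 'v, 'v) tensor3 \<Rightarrow> ('k, 'v, 'v, 'v) tensor3" where
  "Cyc t = t + tau12 (tau23 t) + tau23 (tau12 t)"

text \<open>The canonical maps from \<open>U \<times> (V \<otimes> W)\<close> and from \<open>(U \<otimes> V) \<times> W\<close> to \<open>U \<otimes> V \<otimes> W\<close>.\<close>

definition tens_left ::
  "('k::field \<Rightarrow> 'u::ab_group_add \<Rightarrow> 'u) \<Rightarrow> ('k \<Rightarrow> 'v::ab_group_add \<Rightarrow> 'v)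
    \<Rightarrow> ('k \<Rightarrow> 'w::ab_group_add \<Rightarrow> 'w)
    \<Rightarrow> 'u \<Rightarrow> ('k, 'v, 'w) tensor2 \<Rightarrow> ('k, 'u, 'v, 'w) tensor3" where
  "tens_left s1 s2 s3 u t = t \<star> (\<lambda>v w. tens3 s1 s2 s3 u v w)"

definition tens_right ::
  "('k::field \<Rightarrow> 'u::ab_group_add \<Rightarrow> 'u) \<Rightarrow> ('k \<Rightarrow> 'v::ab_group_add \<Rightarrow> 'v)
    \<Rightarrow> ('k \<Rightarrow> 'w::ab_group_add \<Rightarrow> 'w)
    \<Rightarrow> ('k, 'u, 'v) tensor2 \<Rightarrow> 'w \<Rightarrow> ('k, 'u, 'v, 'w) tensor3" where
  "tens_right s1 s2 s3 t w = t \<star> (\<lambda>u v. tens3 s1 s2 s3 u v w)"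

definition linear_to_tensor ::
  "('k::field \<Rightarrow> 'x::ab_group_add \<Rightarrow> 'x) \<Rightarrow> ('k \<Rightarrow> 'u::ab_group_add \<Rightarrow> 'u)
    \<Rightarrow> ('k \<Rightarrow> 'v::ab_group_add \<Rightarrow> 'v) \<Rightarrow> ('x \<Rightarrow> ('k, 'u, 'v) tensor2) \<Rightarrow> bool" where
  "linear_to_tensor s s1 s2 f \<longleftrightarrow>
    Vector_Spaces.linear s fun_scale f \<and> range f \<subseteq> tensor_space s1 s2"

subsection \<open>Adequacy of the tensor product\<close>

lemma vector_space_fun_scale: "vector_space (fun_scale :: 'k::field \<Rightarrow> ('x \<Rightarrow> 'k) \<Rightarrow> _)"
  by unfold_locales (auto simp: fun_scale_def fun_eq_iff algebra_simps)

lemma vector_space_field: "vector_space ((*) :: 'k::field \<Rightarrow> 'k \<Rightarrow> 'k)"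
  by unfold_locales (auto simp: algebra_simps)

lemma linear_evaluation: "Vector_Spaces.linear fun_scale (*) (\<lambda>t :: 'x \<Rightarrow> 'k::field. t B)"
  by (simp add: Vector_Spaces.linear_iff vector_space_fun_scale vector_space_field)
    (simp add: fun_scale_def)

lemma linear_comp:
  assumes "Vector_Spaces.linear s1 s2 f" "Vector_Spaces.linear s2 s3 l"
  shows "Vector_Spaces.linear s1 s3 (\<lambda>x. l (f x))"
  using Vector_Spaces.linear_compose[OF assms] by (simp add: o_def)

lemma ex_linear_functional_neq_0:
  fixes s :: "'k::field \<Rightarrow> 't::ab_group_add \<Rightarrow> 't"
  assumes "vector_space s" "d \<noteq> 0"
  obtains l where "Vector_Spaces.linear s (*) l" "l d = 1"
proof -
  interpret vector_space_pair s "(*) :: 'k \<Rightarrow> 'k \<Rightarrow> 'k"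
    by (intro vector_space_pair.intro assms vector_space_field)
  have "vs1.independent {d}" using assms(2) by simp
  then show ?thesis
    using that[of "construct {d} (\<lambda>_. 1)"] linear_construct construct_basis by auto
qed

text \<open>If every linear functional on the target is detected by some evaluation, then an assignment
  on evaluations extends linearly.\<close>

lemma linear_extension_from_evaluations:
  fixes s :: "'k::field \<Rightarrow> 't::ab_group_add \<Rightarrow> 't" and p :: "'i \<Rightarrow> 'x \<Rightarrow> 'k"
  assumes s: "vector_space s"
    and ev: "\<And>l. Vector_Spaces.linear s (*) l \<Longrightarrow> \<exists>B. \<forall>i. p i B = l (f i)"
  shows "\<exists>g. Vector_Spaces.linear fun_scale s g \<and> (\<forall>i. g (p i) = f i)"
proof -
  interpret vector_space_pair "fun_scale :: 'k \<Rightarrow> ('x \<Rightarrow> 'k) \<Rightarrow> _" s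
    by (intro vector_space_pair.intro s vector_space_fun_scale)
  obtain Bs where Bs: "Bs \<subseteq> range p" "vs1.independent Bs" "range p \<subseteq> vs1.span Bs"
    using vs1.maximal_independent_subset[of "range p"] by blast
  define g where "g = construct Bs (\<lambda>b. f (inv p b))"
  have lin: "Vector_Spaces.linear fun_scale s g"
    unfolding g_def by (rule linear_construct[OF Bs(2)])
  have "g (p i) = f i" for i
  proof (rule ccontr)
    assume neq: "g (p i) \<noteq> f i"
    obtain l where l: "Vector_Spaces.linear s (*) l" "l (g (p i) - f i) = 1"
      using ex_linear_functional_neq_0[OF s, of "g (p i) - f i"] neq by auto
    obtain B where B: "\<And>j. p j B = l (f j)" using ev[OF l(1)] by blast
    interpret e: vector_space_pair "fun_scale :: 'k \<Rightarrow> ('x \<Rightarrow> 'k) \<Rightarrow> _" "(*) :: 'k \<Rightarrow> 'k \<Rightarrow> 'k"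
      by (intro vector_space_pair.intro vector_space_field vector_space_fun_scale)
    have "Vector_Spaces.linear fun_scale (*) (l \<circ> g)"
      by (rule Vector_Spaces.linear_compose[OF lin l(1)])
    moreover have "(l \<circ> g) b = b B" if "b \<in> Bs" for b
    proof -
      have "p (inv p b) = b" using that Bs(1) by (auto intro: f_inv_into_f)
      then show ?thesis
        using B[of "inv p b"] construct_basis[OF Bs(2) that] by (simp add: g_def)
    qed
    moreover have "p i \<in> vs1.span Bs" using Bs(3) by blast
    ultimately have "(l \<circ> g) (p i) = p i B"
      using e.linear_eq_on[OF _ linear_evaluation] by blast
    then have "l (g (p i)) = l (f i)" using B by simp
    moreover have "l (g (p i) - f i) = l (g (p i)) - l (f i)"
      by (rule module_hom.diff[OF Vector_Spaces.linear.axioms(3)[OF l(1)]])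
    ultimately show False using l(2) by simp
  qed
  then show ?thesis using lin by blast
qed

theorem tensor_universal:
  assumes "vector_space s" "bilinear_map s1 s2 s f"
  shows "\<exists>g. Vector_Spaces.linear fun_scale s g \<and> (\<forall>u v. g (tens s1 s2 u v) = f u v)"
proof -
  have "\<exists>B. \<forall>i. (\<lambda>(u, v). tens s1 s2 u v) i B = l ((\<lambda>(u, v). f u v) i)"
    if "Vector_Spaces.linear s (*) l" for l
  proof -
    have "bilinear_map s1 s2 (*) (\<lambda>u v. l (f u v))"
      using assms(2) unfolding bilinear_map_def by (intro conjI allI linear_comp[OF _ that]) blast+
    then show ?thesis by (intro exI[of _ "\<lambda>u v. l (f u v)"]) (auto simp: tens_def)
  qed
  from linear_extension_from_evaluations[OF assms(1) this] show ?thesis by fastforce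
qed

theorem tensor_universal3:
  assumes "vector_space s" "trilinear_map s1 s2 s3 s f"
  shows "\<exists>g. Vector_Spaces.linear fun_scale s g \<and> (\<forall>u v w. g (tens3 s1 s2 s3 u v w) = f u v w)"
proof -
  have "\<exists>B. \<forall>i. (\<lambda>(u, v, w). tens3 s1 s2 s3 u v w) i B = l ((\<lambda>(u, v, w). f u v w) i)"
    if "Vector_Spaces.linear s (*) l" for l
  proof -
    have "trilinear_map s1 s2 s3 (*) (\<lambda>u v w. l (f u v w))"
      using assms(2) unfolding trilinear_map_def by (intro conjI allI linear_comp[OF _ that]) blast+
    then show ?thesis by (intro exI[of _ "\<lambda>u v w. l (f u v w)"]) (auto simp: tens3_def)
  qed
  from linear_extension_from_evaluations[OF assms(1) this] show ?thesis by fastforce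
qed

theorem tensor_unique:
  fixes g h :: "('k::field, 'u::ab_group_add, 'v::ab_group_add) tensor2 \<Rightarrow> 't::ab_group_add"
  assumes "Vector_Spaces.linear fun_scale s g" "Vector_Spaces.linear fun_scale s h"
    and "\<And>u v. g (tens s1 s2 u v) = h (tens s1 s2 u v)" and "t \<in> tensor_space s1 s2"
  shows "g t = h t"
proof -
  interpret vector_space_pair "fun_scale :: 'k \<Rightarrow> ('k, 'u, 'v) tensor2 \<Rightarrow> _" s
    using assms(1) by (intro vector_space_pair.intro) (auto simp: Vector_Spaces.linear_iff)
  show ?thesis
    using linear_eq_on[OF assms(1,2)] assms(3,4) unfolding tensor_space_def by blast
qed

theorem tensor_unique3:
  fixes g h :: "('k::field, 'u::ab_group_add, 'v::ab_group_add, 'w::ab_group_add) tensor3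
    \<Rightarrow> 't::ab_group_add"
  assumes "Vector_Spaces.linear fun_scale s g" "Vector_Spaces.linear fun_scale s h"
    and "\<And>u v w. g (tens3 s1 s2 s3 u v w) = h (tens3 s1 s2 s3 u v w)"
    and "t \<in> tensor_space3 s1 s2 s3"
  shows "g t = h t"
proof -
  interpret vector_space_pair "fun_scale :: 'k \<Rightarrow> ('k, 'u, 'v, 'w) tensor3 \<Rightarrow> _" s
    using assms(1) by (intro vector_space_pair.intro) (auto simp: Vector_Spaces.linear_iff)
  show ?thesis
    using linear_eq_on[OF assms(1,2)] assms(3,4) unfolding tensor_space3_def by blast
qed

lemma linear_fun_scaleI:
  assumes "vector_space s" "\<And>B. Vector_Spaces.linear s (*) (\<lambda>u. f u B)"
  shows "Vector_Spaces.linear s fun_scale f"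
  using assms by (simp add: Vector_Spaces.linear_iff vector_space_fun_scale)
    (simp add: fun_scale_def fun_eq_iff)

lemma linear_guarded_form:
  assumes "vector_space s" "p \<Longrightarrow> Vector_Spaces.linear s ((*) :: 'k::field \<Rightarrow> _) f"
  shows "Vector_Spaces.linear s (*) (\<lambda>u. if p then f u else 0)"
  using assms by (cases p) (simp_all add: Vector_Spaces.linear_iff vector_space_field)

lemma bilinear_tens:
  assumes "vector_space s1" "vector_space s2"
  shows "bilinear_map s1 s2 fun_scale (tens s1 s2)"
  by (subst bilinear_map_def, unfold tens_def,
      intro conjI allI linear_fun_scaleI linear_guarded_form assms)
    (simp_all add: bilinear_map_def)

lemma trilinear_tens3:
  assumes "vector_space s1" "vector_space s2" "vector_space s3"
  shows "trilinear_map s1 s2 s3 fun_scale (tens3 s1 s2 s3)"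
  by (subst trilinear_map_def, unfold tens3_def,
      intro conjI allI linear_fun_scaleI linear_guarded_form assms)
    (simp_all add: trilinear_map_def)

lemma sweedler_tens:
  assumes "bilinear_map s1 s2 fun_scale f"
  shows "tens s1 s2 u v \<star> f = f u v"
proof -
  have "bilinear_map s1 s2 (*) (\<lambda>u v. f u v B)" for B
    using assms unfolding bilinear_map_def by (intro conjI allI linear_comp[OF _ linear_evaluation]) blast+
  then show ?thesis by (simp add: sweedler_def tens_def fun_eq_iff)
qed

lemma linear_sweedler: "Vector_Spaces.linear fun_scale fun_scale (\<lambda>t. t \<star> f)"
  by (simp add: Vector_Spaces.linear_iff vector_space_fun_scale)
    (simp add: sweedler_def fun_scale_def fun_eq_iff)

lemma tau_tens: "tau (tens s1 s2 u v) = tens s2 s1 v u"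
  by (auto simp: tau_def tens_def fun_eq_iff bilinear_map_def)

lemma tau12_tens3: "tau12 (tens3 s1 s2 s3 u v w) = tens3 s2 s1 s3 v u w"
  by (auto simp: tau12_def tens3_def fun_eq_iff trilinear_map_def)

lemma tau23_tens3: "tau23 (tens3 s1 s2 s3 u v w) = tens3 s1 s3 s2 u w v"
  by (auto simp: tau23_def tens3_def fun_eq_iff trilinear_map_def)

section \<open>Hom-Lie algebras, coalgebras and bialgebras\<close>

definition hom_vector_space ::
  "('k::field \<Rightarrow> 'v::ab_group_add \<Rightarrow> 'v) \<Rightarrow> ('v \<Rightarrow> 'v) \<Rightarrow> bool" where
  "hom_vector_space s \<alpha> \<longleftrightarrow> vector_space s \<and> Vector_Spaces.linear s s \<alpha>"

definition antisymmetric :: "('u \<Rightarrow> 'u \<Rightarrow> 't::group_add) \<Rightarrow> bool" where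
  "antisymmetric f \<longleftrightarrow> (\<forall>u v. f u v = - f v u)"

definition co_antisymmetric :: "('x \<Rightarrow> ('k::field, 'v, 'v) tensor2) \<Rightarrow> bool" where
  "co_antisymmetric f \<longleftrightarrow> (\<forall>x. f x = - tau (f x))"

definition hom_lie_algebra ::
  "('k::field \<Rightarrow> 'v::ab_group_add \<Rightarrow> 'v) \<Rightarrow> ('v \<Rightarrow> 'v) \<Rightarrow> ('v \<Rightarrow> 'v \<Rightarrow> 'v) \<Rightarrow> bool" where
  "hom_lie_algebra s \<alpha> br \<longleftrightarrow>
    hom_vector_space s \<alpha> \<and> bilinear_map s s s br \<and> antisymmetric br \<and>
    (\<forall>x y z. br (\<alpha> x) (br y z) + br (\<alpha> y) (br z x) + br (\<alpha> z) (br x y) = 0)"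

definition hom_lie_coalgebra ::
  "('k::field \<Rightarrow> 'v::ab_group_add \<Rightarrow> 'v) \<Rightarrow> ('v \<Rightarrow> 'v)
    \<Rightarrow> ('v \<Rightarrow> ('k, 'v, 'v) tensor2) \<Rightarrow> bool" where
  "hom_lie_coalgebra s \<alpha> \<delta> \<longleftrightarrow>
    hom_vector_space s \<alpha> \<and> linear_to_tensor s s s \<delta> \<and> co_antisymmetric \<delta> \<and>
    (\<forall>x. \<delta> x \<star> (\<lambda>x1 x2. tens_left s s s (\<alpha> x1) (\<delta> x2)) =
      \<delta> x \<star> (\<lambda>x1 x2. tens_right s s s (\<delta> x1) (\<alpha> x2)) +
      tau12 (\<delta> x \<star> (\<lambda>x1 x2. tens_left s s s (\<alpha> x1) (\<delta> x2))))"

text \<open>\<open>[z, t]\<close> and \<open>[t, z]\<close> for a vector \<open>z\<close> and a tensor \<open>t\<close>.\<close>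

definition bracket_left ::
  "('k::field \<Rightarrow> 'v::ab_group_add \<Rightarrow> 'v) \<Rightarrow> ('v \<Rightarrow> 'v) \<Rightarrow> ('v \<Rightarrow> 'v \<Rightarrow> 'v)
    \<Rightarrow> 'v \<Rightarrow> ('k, 'v, 'v) tensor2 \<Rightarrow> ('k, 'v, 'v) tensor2" where
  "bracket_left s \<alpha> br z t =
    t \<star> (\<lambda>u1 u2. tens s s (br z u1) (\<alpha> u2) + tens s s (\<alpha> u1) (br z u2))"

definition bracket_right ::
  "('k::field \<Rightarrow> 'v::ab_group_add \<Rightarrow> 'v) \<Rightarrow> ('v \<Rightarrow> 'v) \<Rightarrow> ('v \<Rightarrow> 'v \<Rightarrow> 'v)
    \<Rightarrow> ('k, 'v, 'v) tensor2 \<Rightarrow> 'v \<Rightarrow> ('k, 'v, 'v) tensor2" where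
  "bracket_right s \<alpha> br t z =
    t \<star> (\<lambda>u1 u2. tens s s (br u1 z) (\<alpha> u2) + tens s s (\<alpha> u1) (br u2 z))"

definition hom_lie_bialgebra ::
  "('k::field \<Rightarrow> 'v::ab_group_add \<Rightarrow> 'v) \<Rightarrow> ('v \<Rightarrow> 'v) \<Rightarrow> ('v \<Rightarrow> 'v \<Rightarrow> 'v)
    \<Rightarrow> ('v \<Rightarrow> ('k, 'v, 'v) tensor2) \<Rightarrow> bool" where
  "hom_lie_bialgebra s \<alpha> br \<delta> \<longleftrightarrow>
    hom_lie_algebra s \<alpha> br \<and> hom_lie_coalgebra s \<alpha> \<delta> \<and>
    (\<forall>x y. \<delta> (br x y) = bracket_left s \<alpha> br (\<alpha> x) (\<delta> y) + bracket_right s \<alpha> br (\<delta> x) (\<alpha> y))"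

section \<open>The data on a pair of Hom-vector spaces\<close>

record ('k, 'a, 'h) hom_datum =
  scaleA :: "'k \<Rightarrow> 'a \<Rightarrow> 'a"
  scaleH :: "'k \<Rightarrow> 'h \<Rightarrow> 'h"
  alphaA :: "'a \<Rightarrow> 'a"
  alphaH :: "'h \<Rightarrow> 'h"
  bracketA :: "'a \<Rightarrow> 'a \<Rightarrow> 'a"
  bracketH :: "'h \<Rightarrow> 'h \<Rightarrow> 'h"
  cobracketA :: "'a \<Rightarrow> ('k, 'a, 'a) tensor2"
  cobracketH :: "'h \<Rightarrow> ('k, 'h, 'h) tensor2"
  left_action :: "'h \<Rightarrow> 'a \<Rightarrow> 'a"
  right_action :: "'h \<Rightarrow> 'a \<Rightarrow> 'h"
  cocycle_sigma :: "'h \<Rightarrow> 'h \<Rightarrow> 'a"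
  cocycle_theta :: "'a \<Rightarrow> 'a \<Rightarrow> 'h"
  coaction_phi :: "'a \<Rightarrow> ('k, 'h, 'a) tensor2"
  coaction_psi :: "'h \<Rightarrow> ('k, 'h, 'a) tensor2"
  cycle_P :: "'a \<Rightarrow> ('k, 'h, 'h) tensor2"
  cycle_Q :: "'h \<Rightarrow> ('k, 'a, 'a) tensor2"

text \<open>
  In the locale below, subscripts of \<open>\<otimes>\<close> name the factors of the tensor product; a bar
  separates the vector from the tensor it is multiplied with.  In Sigma notation the components are
  written as follows: \<open>a1, a2\<close> (resp. \<open>x1, x2\<close>) for the cobrackets; \<open>am, a0\<close> for
  \<open>\<phi>(a) = a\<^bsub>(-1)\<^esub> \<otimes> a\<^bsub>(0)\<^esub>\<close>; \<open>x0, xp\<close> for \<open>\<psi>(x) = x\<^bsub>(0)\<^esub> \<otimes> x\<^bsub>(1)\<^esub>\<close>; \<open>p1, p2\<close> for the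
  components of \<open>P\<close>; \<open>q1, q2\<close> for those of \<open>Q\<close>.
\<close>

locale hom_datum =
  fixes D :: "('k::field, 'a::ab_group_add, 'h::ab_group_add) hom_datum"
begin

abbreviation sA where "sA \<equiv> scaleA D"
abbreviation sH where "sH \<equiv> scaleH D"
abbreviation aA ("\<alpha>\<^sub>A") where "\<alpha>\<^sub>A \<equiv> alphaA D"
abbreviation aH ("\<alpha>\<^sub>H") where "\<alpha>\<^sub>H \<equiv> alphaH D"
abbreviation brA ("\<lbrakk>_, _\<rbrakk>\<^sub>A") where "\<lbrakk>a, b\<rbrakk>\<^sub>A \<equiv> bracketA D a b"
abbreviation brH ("\<lbrakk>_, _\<rbrakk>\<^sub>H") where "\<lbrakk>x, y\<rbrakk>\<^sub>H \<equiv> bracketH D x y"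
abbreviation coA ("\<delta>\<^sub>A") where "\<delta>\<^sub>A \<equiv> cobracketA D"
abbreviation coH ("\<delta>\<^sub>H") where "\<delta>\<^sub>H \<equiv> cobracketH D"
abbreviation actl (infix "\<triangleright>" 80) where "x \<triangleright> a \<equiv> left_action D x a"
abbreviation actr (infix "\<triangleleft>" 80) where "x \<triangleleft> a \<equiv> right_action D x a"
abbreviation sigma ("\<sigma>") where "\<sigma> \<equiv> cocycle_sigma D"
abbreviation theta ("\<theta>") where "\<theta> \<equiv> cocycle_theta D"
abbreviation phi ("\<phi>") where "\<phi> \<equiv> coaction_phi D"
abbreviation psi ("\<psi>") where "\<psi> \<equiv> coaction_psi D"
abbreviation P where "P \<equiv> cycle_P D"
abbreviation Q where "Q \<equiv> cycle_Q D"

abbreviation tAA (infix "\<otimes>\<^bsub>AA\<^esub>" 76) where "a \<otimes>\<^bsub>AA\<^esub> b \<equiv> tens sA sA a b"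
abbreviation tHA (infix "\<otimes>\<^bsub>HA\<^esub>" 76) where "x \<otimes>\<^bsub>HA\<^esub> a \<equiv> tens sH sA x a"
abbreviation tHH (infix "\<otimes>\<^bsub>HH\<^esub>" 76) where "x \<otimes>\<^bsub>HH\<^esub> y \<equiv> tens sH sH x y"

abbreviation tA_AA (infix "\<otimes>\<^bsub>A|AA\<^esub>" 76) where "a \<otimes>\<^bsub>A|AA\<^esub> t \<equiv> tens_left sA sA sA a t"
abbreviation tAA_A (infix "\<otimes>\<^bsub>AA|A\<^esub>" 76) where "t \<otimes>\<^bsub>AA|A\<^esub> a \<equiv> tens_right sA sA sA t a"
abbreviation tH_HH (infix "\<otimes>\<^bsub>H|HH\<^esub>" 76) where "x \<otimes>\<^bsub>H|HH\<^esub> t \<equiv> tens_left sH sH sH x t"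
abbreviation tHH_H (infix "\<otimes>\<^bsub>HH|H\<^esub>" 76) where "t \<otimes>\<^bsub>HH|H\<^esub> x \<equiv> tens_right sH sH sH t x"
abbreviation tH_HA (infix "\<otimes>\<^bsub>H|HA\<^esub>" 76) where "x \<otimes>\<^bsub>H|HA\<^esub> t \<equiv> tens_left sH sH sA x t"
abbreviation tHH_A (infix "\<otimes>\<^bsub>HH|A\<^esub>" 76) where "t \<otimes>\<^bsub>HH|A\<^esub> a \<equiv> tens_right sH sH sA t a"
abbreviation tH_AA (infix "\<otimes>\<^bsub>H|AA\<^esub>" 76) where "x \<otimes>\<^bsub>H|AA\<^esub> t \<equiv> tens_left sH sA sA x t"
abbreviation tHA_A (infix "\<otimes>\<^bsub>HA|A\<^esub>" 76) where "t \<otimes>\<^bsub>HA|A\<^esub> a \<equiv> tens_right sH sA sA t a"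
abbreviation tA_HA (infix "\<otimes>\<^bsub>A|HA\<^esub>" 76) where "a \<otimes>\<^bsub>A|HA\<^esub> t \<equiv> tens_left sA sH sA a t"
abbreviation tHA_H (infix "\<otimes>\<^bsub>HA|H\<^esub>" 76) where "t \<otimes>\<^bsub>HA|H\<^esub> x \<equiv> tens_right sH sA sH t x"

subsection \<open>Cocycle cross product systems\<close>

definition theta_hom_lie_algebra :: bool where
  "theta_hom_lie_algebra \<longleftrightarrow>
    antisymmetric (bracketA D) \<and> antisymmetric \<theta> \<and>
    (\<forall>a b c.
      \<theta> a b \<triangleleft> \<alpha>\<^sub>A c + \<theta> b c \<triangleleft> \<alpha>\<^sub>A a + \<theta> c a \<triangleleft> \<alpha>\<^sub>A b
      = \<theta> (\<alpha>\<^sub>A a) \<lbrakk>b, c\<rbrakk>\<^sub>A + \<theta> (\<alpha>\<^sub>A b) \<lbrakk>c, a\<rbrakk>\<^sub>A + \<theta> (\<alpha>\<^sub>A c) \<lbrakk>a, b\<rbrakk>\<^sub>A) \<and>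
    (\<forall>a b c.
      \<lbrakk>\<lbrakk>a, b\<rbrakk>\<^sub>A, \<alpha>\<^sub>A c\<rbrakk>\<^sub>A + \<lbrakk>\<lbrakk>b, c\<rbrakk>\<^sub>A, \<alpha>\<^sub>A a\<rbrakk>\<^sub>A + \<lbrakk>\<lbrakk>c, a\<rbrakk>\<^sub>A, \<alpha>\<^sub>A b\<rbrakk>\<^sub>A
      = - (\<theta> a b \<triangleright> \<alpha>\<^sub>A c + \<theta> b c \<triangleright> \<alpha>\<^sub>A a + \<theta> c a \<triangleright> \<alpha>\<^sub>A b))"

definition sigma_hom_lie_algebra :: bool where
  "sigma_hom_lie_algebra \<longleftrightarrow>
    antisymmetric (bracketH D) \<and> antisymmetric \<sigma> \<and>
    (\<forall>x y z.
      \<alpha>\<^sub>H x \<triangleright> \<sigma> y z + \<alpha>\<^sub>H y \<triangleright> \<sigma> z x + \<alpha>\<^sub>H z \<triangleright> \<sigma> x y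
      = \<sigma> \<lbrakk>x, y\<rbrakk>\<^sub>H (\<alpha>\<^sub>H z) + \<sigma> \<lbrakk>y, z\<rbrakk>\<^sub>H (\<alpha>\<^sub>H x) + \<sigma> \<lbrakk>z, x\<rbrakk>\<^sub>H (\<alpha>\<^sub>H y)) \<and>
    (\<forall>x y z.
      \<lbrakk>\<lbrakk>x, y\<rbrakk>\<^sub>H, \<alpha>\<^sub>H z\<rbrakk>\<^sub>H + \<lbrakk>\<lbrakk>y, z\<rbrakk>\<^sub>H, \<alpha>\<^sub>H x\<rbrakk>\<^sub>H + \<lbrakk>\<lbrakk>z, x\<rbrakk>\<^sub>H, \<alpha>\<^sub>H y\<rbrakk>\<^sub>H
      = \<alpha>\<^sub>H x \<triangleleft> \<sigma> y z + \<alpha>\<^sub>H y \<triangleleft> \<sigma> z x + \<alpha>\<^sub>H z \<triangleleft> \<sigma> x y)"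

definition TM1 :: bool where
  "TM1 \<longleftrightarrow> (\<forall>a x y.
    \<lbrakk>x, y\<rbrakk>\<^sub>H \<triangleright> \<alpha>\<^sub>A a + \<lbrakk>\<sigma> x y, \<alpha>\<^sub>A a\<rbrakk>\<^sub>A
    = \<alpha>\<^sub>H x \<triangleright> (y \<triangleright> a) - \<alpha>\<^sub>H y \<triangleright> (x \<triangleright> a) + \<sigma> (\<alpha>\<^sub>H x) (y \<triangleleft> a) + \<sigma> (x \<triangleleft> a) (\<alpha>\<^sub>H y))"

definition TM2 :: bool where
  "TM2 \<longleftrightarrow> (\<forall>a b x.
    \<alpha>\<^sub>H x \<triangleleft> \<lbrakk>a, b\<rbrakk>\<^sub>A + \<lbrakk>\<alpha>\<^sub>H x, \<theta> a b\<rbrakk>\<^sub>H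
    = (x \<triangleleft> a) \<triangleleft> \<alpha>\<^sub>A b - (x \<triangleleft> b) \<triangleleft> \<alpha>\<^sub>A a + \<theta> (x \<triangleright> a) (\<alpha>\<^sub>A b) + \<theta> (\<alpha>\<^sub>A a) (x \<triangleright> b))"

definition TBB1 :: bool where
  "TBB1 \<longleftrightarrow> (\<forall>a b x.
    \<alpha>\<^sub>H x \<triangleright> \<lbrakk>a, b\<rbrakk>\<^sub>A + \<sigma> (\<alpha>\<^sub>H x) (\<theta> a b)
    = \<lbrakk>x \<triangleright> a, \<alpha>\<^sub>A b\<rbrakk>\<^sub>A + \<lbrakk>\<alpha>\<^sub>A a, x \<triangleright> b\<rbrakk>\<^sub>A + (x \<triangleleft> a) \<triangleright> \<alpha>\<^sub>A b - (x \<triangleleft> b) \<triangleright> \<alpha>\<^sub>A a)"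

definition TBB2 :: bool where
  "TBB2 \<longleftrightarrow> (\<forall>a x y.
    \<lbrakk>x, y\<rbrakk>\<^sub>H \<triangleleft> \<alpha>\<^sub>A a + \<theta> (\<sigma> x y) (\<alpha>\<^sub>A a)
    = \<lbrakk>\<alpha>\<^sub>H x, y \<triangleleft> a\<rbrakk>\<^sub>H + \<lbrakk>x \<triangleleft> a, \<alpha>\<^sub>H y\<rbrakk>\<^sub>H + \<alpha>\<^sub>H x \<triangleleft> (y \<triangleright> a) - \<alpha>\<^sub>H y \<triangleleft> (x \<triangleright> a))"

definition cocycle_cross_product_system :: bool where
  "cocycle_cross_product_system \<longleftrightarrow>
    theta_hom_lie_algebra \<and> sigma_hom_lie_algebra \<and> TM1 \<and> TM2 \<and> TBB1 \<and> TBB2"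

subsection \<open>Cycle cross coproduct systems\<close>

definition Q_hom_lie_coalgebra :: bool where
  "Q_hom_lie_coalgebra \<longleftrightarrow>
    co_antisymmetric \<delta>\<^sub>A \<and> co_antisymmetric Q \<and>
    (\<forall>x. Cyc (\<psi> x \<star> (\<lambda>x0 xp. Q x0 \<otimes>\<^bsub>AA|A\<^esub> \<alpha>\<^sub>A xp))
      = Cyc (Q x \<star> (\<lambda>q1 q2. \<alpha>\<^sub>A q1 \<otimes>\<^bsub>A|AA\<^esub> \<delta>\<^sub>A q2))) \<and>
    (\<forall>a. Cyc (\<delta>\<^sub>A a \<star> (\<lambda>a1 a2. \<delta>\<^sub>A a1 \<otimes>\<^bsub>AA|A\<^esub> \<alpha>\<^sub>A a2))
      = - Cyc (\<phi> a \<star> (\<lambda>am a0. Q am \<otimes>\<^bsub>AA|A\<^esub> \<alpha>\<^sub>A a0)))"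

definition P_hom_lie_coalgebra :: bool where
  "P_hom_lie_coalgebra \<longleftrightarrow>
    co_antisymmetric \<delta>\<^sub>H \<and> co_antisymmetric P \<and>
    (\<forall>a. Cyc (\<phi> a \<star> (\<lambda>am a0. \<alpha>\<^sub>H am \<otimes>\<^bsub>H|HH\<^esub> P a0))
      = Cyc (P a \<star> (\<lambda>p1 p2. \<delta>\<^sub>H p1 \<otimes>\<^bsub>HH|H\<^esub> \<alpha>\<^sub>H p2))) \<and>
    (\<forall>x. Cyc (\<delta>\<^sub>H x \<star> (\<lambda>x1 x2. \<delta>\<^sub>H x1 \<otimes>\<^bsub>HH|H\<^esub> \<alpha>\<^sub>H x2))
      = Cyc (\<psi> x \<star> (\<lambda>x0 xp. \<alpha>\<^sub>H x0 \<otimes>\<^bsub>H|HH\<^esub> P xp)))"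

definition TM3 :: bool where
  "TM3 \<longleftrightarrow> (\<forall>a.
    \<phi> a \<star> (\<lambda>am a0. \<delta>\<^sub>H am \<otimes>\<^bsub>HH|A\<^esub> \<alpha>\<^sub>A a0)
    + \<delta>\<^sub>A a \<star> (\<lambda>a1 a2. P a1 \<otimes>\<^bsub>HH|A\<^esub> \<alpha>\<^sub>A a2)
    = \<phi> a \<star> (\<lambda>am a0. \<alpha>\<^sub>H am \<otimes>\<^bsub>H|HA\<^esub> \<phi> a0)
    - tau12 (\<phi> a \<star> (\<lambda>am a0. \<alpha>\<^sub>H am \<otimes>\<^bsub>H|HA\<^esub> \<phi> a0))
    + P a \<star> (\<lambda>p1 p2. \<alpha>\<^sub>H p1 \<otimes>\<^bsub>H|HA\<^esub> \<psi> p2)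
    + tau23 (P a \<star> (\<lambda>p1 p2. \<psi> p1 \<otimes>\<^bsub>HA|H\<^esub> \<alpha>\<^sub>H p2)))"

definition TM4 :: bool where
  "TM4 \<longleftrightarrow> (\<forall>x.
    \<psi> x \<star> (\<lambda>x0 xp. \<alpha>\<^sub>H x0 \<otimes>\<^bsub>H|AA\<^esub> \<delta>\<^sub>A xp)
    + \<delta>\<^sub>H x \<star> (\<lambda>x1 x2. \<alpha>\<^sub>H x1 \<otimes>\<^bsub>H|AA\<^esub> Q x2)
    = \<psi> x \<star> (\<lambda>x0 xp. \<psi> x0 \<otimes>\<^bsub>HA|A\<^esub> \<alpha>\<^sub>A xp)
    - tau23 (\<psi> x \<star> (\<lambda>x0 xp. \<psi> x0 \<otimes>\<^bsub>HA|A\<^esub> \<alpha>\<^sub>A xp))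
    + Q x \<star> (\<lambda>q1 q2. \<phi> q1 \<otimes>\<^bsub>HA|A\<^esub> \<alpha>\<^sub>A q2)
    + tau12 (Q x \<star> (\<lambda>q1 q2. \<alpha>\<^sub>A q1 \<otimes>\<^bsub>A|HA\<^esub> \<phi> q2)))"

definition TBB3 :: bool where
  "TBB3 \<longleftrightarrow> (\<forall>a.
    \<phi> a \<star> (\<lambda>am a0. \<alpha>\<^sub>H am \<otimes>\<^bsub>H|AA\<^esub> \<delta>\<^sub>A a0)
    + P a \<star> (\<lambda>p1 p2. \<alpha>\<^sub>H p1 \<otimes>\<^bsub>H|AA\<^esub> Q p2)
    = \<delta>\<^sub>A a \<star> (\<lambda>a1 a2. \<phi> a1 \<otimes>\<^bsub>HA|A\<^esub> \<alpha>\<^sub>A a2)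
    + tau12 (\<delta>\<^sub>A a \<star> (\<lambda>a1 a2. \<alpha>\<^sub>A a1 \<otimes>\<^bsub>A|HA\<^esub> \<phi> a2))
    + \<phi> a \<star> (\<lambda>am a0. \<psi> am \<otimes>\<^bsub>HA|A\<^esub> \<alpha>\<^sub>A a0)
    - tau23 (\<phi> a \<star> (\<lambda>am a0. \<psi> am \<otimes>\<^bsub>HA|A\<^esub> \<alpha>\<^sub>A a0)))"

definition TBB4 :: bool where
  "TBB4 \<longleftrightarrow> (\<forall>x.
    \<psi> x \<star> (\<lambda>x0 xp. \<delta>\<^sub>H x0 \<otimes>\<^bsub>HH|A\<^esub> \<alpha>\<^sub>A xp)
    + Q x \<star> (\<lambda>q1 q2. P q1 \<otimes>\<^bsub>HH|A\<^esub> \<alpha>\<^sub>A q2)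
    = \<delta>\<^sub>H x \<star> (\<lambda>x1 x2. \<alpha>\<^sub>H x1 \<otimes>\<^bsub>H|HA\<^esub> \<psi> x2)
    + tau23 (\<delta>\<^sub>H x \<star> (\<lambda>x1 x2. \<psi> x1 \<otimes>\<^bsub>HA|H\<^esub> \<alpha>\<^sub>H x2))
    + \<psi> x \<star> (\<lambda>x0 xp. \<alpha>\<^sub>H x0 \<otimes>\<^bsub>H|HA\<^esub> \<phi> xp)
    - tau12 (\<psi> x \<star> (\<lambda>x0 xp. \<alpha>\<^sub>H x0 \<otimes>\<^bsub>H|HA\<^esub> \<phi> xp)))"

definition cycle_cross_coproduct_system :: bool where
  "cycle_cross_coproduct_system \<longleftrightarrow>
    Q_hom_lie_coalgebra \<and> P_hom_lie_coalgebra \<and> TM3 \<and> TM4 \<and> TBB3 \<and> TBB4"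

subsection \<open>Compatibility conditions\<close>

definition TBB5 :: bool where
  "TBB5 \<longleftrightarrow> (\<forall>a x.
    \<delta>\<^sub>A (x \<triangleright> a) + Q (x \<triangleleft> a)
    = \<delta>\<^sub>A a \<star> (\<lambda>a1 a2. (\<alpha>\<^sub>H x \<triangleright> a1) \<otimes>\<^bsub>AA\<^esub> \<alpha>\<^sub>A a2)
    + \<delta>\<^sub>A a \<star> (\<lambda>a1 a2. \<alpha>\<^sub>A a1 \<otimes>\<^bsub>AA\<^esub> (\<alpha>\<^sub>H x \<triangleright> a2))
    + \<psi> x \<star> (\<lambda>x0 xp. (x0 \<triangleright> \<alpha>\<^sub>A a) \<otimes>\<^bsub>AA\<^esub> \<alpha>\<^sub>A xp)
    - \<psi> x \<star> (\<lambda>x0 xp. \<alpha>\<^sub>A xp \<otimes>\<^bsub>AA\<^esub> (x0 \<triangleright> \<alpha>\<^sub>A a))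
    + bracket_right sA \<alpha>\<^sub>A (bracketA D) (Q x) (\<alpha>\<^sub>A a)
    + \<phi> a \<star> (\<lambda>am a0. \<sigma> (\<alpha>\<^sub>H x) am \<otimes>\<^bsub>AA\<^esub> \<alpha>\<^sub>A a0)
    - \<phi> a \<star> (\<lambda>am a0. \<alpha>\<^sub>A a0 \<otimes>\<^bsub>AA\<^esub> \<sigma> (\<alpha>\<^sub>H x) am))"

definition TBB6 :: bool where
  "TBB6 \<longleftrightarrow> (\<forall>a x.
    \<delta>\<^sub>H (x \<triangleleft> a) + P (x \<triangleright> a)
    = \<delta>\<^sub>H x \<star> (\<lambda>x1 x2. \<alpha>\<^sub>H x1 \<otimes>\<^bsub>HH\<^esub> (x2 \<triangleleft> \<alpha>\<^sub>A a))
    + \<delta>\<^sub>H x \<star> (\<lambda>x1 x2. (x1 \<triangleleft> \<alpha>\<^sub>A a) \<otimes>\<^bsub>HH\<^esub> \<alpha>\<^sub>H x2)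
    + \<phi> a \<star> (\<lambda>am a0. \<alpha>\<^sub>H am \<otimes>\<^bsub>HH\<^esub> (\<alpha>\<^sub>H x \<triangleleft> a0))
    - \<phi> a \<star> (\<lambda>am a0. (\<alpha>\<^sub>H x \<triangleleft> a0) \<otimes>\<^bsub>HH\<^esub> \<alpha>\<^sub>H am)
    + bracket_left sH \<alpha>\<^sub>H (bracketH D) (\<alpha>\<^sub>H x) (P a)
    + \<psi> x \<star> (\<lambda>x0 xp. \<alpha>\<^sub>H x0 \<otimes>\<^bsub>HH\<^esub> \<theta> xp (\<alpha>\<^sub>A a))
    - \<psi> x \<star> (\<lambda>x0 xp. \<theta> xp (\<alpha>\<^sub>A a) \<otimes>\<^bsub>HH\<^esub> \<alpha>\<^sub>H x0))"

definition TBB7 :: bool where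
  "TBB7 \<longleftrightarrow> (\<forall>a b.
    \<phi> \<lbrakk>a, b\<rbrakk>\<^sub>A + \<psi> (\<theta> a b)
    = \<phi> a \<star> (\<lambda>am a0. \<alpha>\<^sub>H am \<otimes>\<^bsub>HA\<^esub> \<lbrakk>a0, \<alpha>\<^sub>A b\<rbrakk>\<^sub>A)
    + \<phi> b \<star> (\<lambda>bm b0. \<alpha>\<^sub>H bm \<otimes>\<^bsub>HA\<^esub> \<lbrakk>\<alpha>\<^sub>A a, b0\<rbrakk>\<^sub>A)
    + \<phi> a \<star> (\<lambda>am a0. (am \<triangleleft> \<alpha>\<^sub>A b) \<otimes>\<^bsub>HA\<^esub> \<alpha>\<^sub>A a0)
    - \<phi> b \<star> (\<lambda>bm b0. (bm \<triangleleft> \<alpha>\<^sub>A a) \<otimes>\<^bsub>HA\<^esub> \<alpha>\<^sub>A b0)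
    + \<delta>\<^sub>A b \<star> (\<lambda>b1 b2. \<theta> (\<alpha>\<^sub>A a) b1 \<otimes>\<^bsub>HA\<^esub> \<alpha>\<^sub>A b2)
    + \<delta>\<^sub>A a \<star> (\<lambda>a1 a2. \<theta> a1 (\<alpha>\<^sub>A b) \<otimes>\<^bsub>HA\<^esub> \<alpha>\<^sub>A a2)
    + P a \<star> (\<lambda>p1 p2. \<alpha>\<^sub>H p1 \<otimes>\<^bsub>HA\<^esub> (p2 \<triangleright> \<alpha>\<^sub>A b))
    - P b \<star> (\<lambda>p1 p2. \<alpha>\<^sub>H p1 \<otimes>\<^bsub>HA\<^esub> (p2 \<triangleright> \<alpha>\<^sub>A a)))"

definition TBB8 :: bool where
  "TBB8 \<longleftrightarrow> (\<forall>x y.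
    \<psi> \<lbrakk>x, y\<rbrakk>\<^sub>H + \<phi> (\<sigma> x y)
    = \<psi> y \<star> (\<lambda>y0 yp. \<lbrakk>\<alpha>\<^sub>H x, y0\<rbrakk>\<^sub>H \<otimes>\<^bsub>HA\<^esub> \<alpha>\<^sub>A yp)
    + \<psi> x \<star> (\<lambda>x0 xp. \<lbrakk>x0, \<alpha>\<^sub>H y\<rbrakk>\<^sub>H \<otimes>\<^bsub>HA\<^esub> \<alpha>\<^sub>A xp)
    + \<psi> y \<star> (\<lambda>y0 yp. \<alpha>\<^sub>H y0 \<otimes>\<^bsub>HA\<^esub> (\<alpha>\<^sub>H x \<triangleright> yp))
    - \<psi> x \<star> (\<lambda>x0 xp. \<alpha>\<^sub>H x0 \<otimes>\<^bsub>HA\<^esub> (\<alpha>\<^sub>H y \<triangleright> xp))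
    + \<delta>\<^sub>H x \<star> (\<lambda>x1 x2. \<alpha>\<^sub>H x1 \<otimes>\<^bsub>HA\<^esub> \<sigma> x2 (\<alpha>\<^sub>H y))
    + \<delta>\<^sub>H y \<star> (\<lambda>y1 y2. \<alpha>\<^sub>H y1 \<otimes>\<^bsub>HA\<^esub> \<sigma> (\<alpha>\<^sub>H x) y2)
    + Q y \<star> (\<lambda>q1 q2. (\<alpha>\<^sub>H x \<triangleleft> q1) \<otimes>\<^bsub>HA\<^esub> \<alpha>\<^sub>A q2)
    - Q x \<star> (\<lambda>q1 q2. (\<alpha>\<^sub>H y \<triangleleft> q1) \<otimes>\<^bsub>HA\<^esub> \<alpha>\<^sub>A q2))"

definition TLB1 :: bool where
  "TLB1 \<longleftrightarrow> (\<forall>a b.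
    \<delta>\<^sub>H (\<theta> a b) + P \<lbrakk>a, b\<rbrakk>\<^sub>A
    = \<phi> a \<star> (\<lambda>am a0. \<alpha>\<^sub>H am \<otimes>\<^bsub>HH\<^esub> \<theta> a0 (\<alpha>\<^sub>A b))
    + \<phi> b \<star> (\<lambda>bm b0. \<alpha>\<^sub>H bm \<otimes>\<^bsub>HH\<^esub> \<theta> (\<alpha>\<^sub>A a) b0)
    - \<phi> b \<star> (\<lambda>bm b0. \<theta> (\<alpha>\<^sub>A a) b0 \<otimes>\<^bsub>HH\<^esub> \<alpha>\<^sub>H bm)
    - \<phi> a \<star> (\<lambda>am a0. \<theta> a0 (\<alpha>\<^sub>A b) \<otimes>\<^bsub>HH\<^esub> \<alpha>\<^sub>H am)
    + P a \<star> (\<lambda>p1 p2. \<alpha>\<^sub>H p1 \<otimes>\<^bsub>HH\<^esub> (p2 \<triangleleft> \<alpha>\<^sub>A b))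
    + P a \<star> (\<lambda>p1 p2. (p1 \<triangleleft> \<alpha>\<^sub>A b) \<otimes>\<^bsub>HH\<^esub> \<alpha>\<^sub>H p2)
    - P b \<star> (\<lambda>p1 p2. (p1 \<triangleleft> \<alpha>\<^sub>A a) \<otimes>\<^bsub>HH\<^esub> \<alpha>\<^sub>H p2)
    - P b \<star> (\<lambda>p1 p2. \<alpha>\<^sub>H p1 \<otimes>\<^bsub>HH\<^esub> (p2 \<triangleleft> \<alpha>\<^sub>A a)))"

definition TLB2 :: bool where
  "TLB2 \<longleftrightarrow> (\<forall>x y.
    \<delta>\<^sub>A (\<sigma> x y) + Q \<lbrakk>x, y\<rbrakk>\<^sub>H
    = \<psi> x \<star> (\<lambda>x0 xp. \<sigma> x0 (\<alpha>\<^sub>H y) \<otimes>\<^bsub>AA\<^esub> \<alpha>\<^sub>A xp)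
    + \<psi> y \<star> (\<lambda>y0 yp. \<sigma> (\<alpha>\<^sub>H x) y0 \<otimes>\<^bsub>AA\<^esub> \<alpha>\<^sub>A yp)
    - \<psi> y \<star> (\<lambda>y0 yp. \<alpha>\<^sub>A yp \<otimes>\<^bsub>AA\<^esub> \<sigma> (\<alpha>\<^sub>H x) y0)
    - \<psi> x \<star> (\<lambda>x0 xp. \<alpha>\<^sub>A xp \<otimes>\<^bsub>AA\<^esub> \<sigma> x0 (\<alpha>\<^sub>H y))
    + Q y \<star> (\<lambda>q1 q2. (\<alpha>\<^sub>H x \<triangleright> q1) \<otimes>\<^bsub>AA\<^esub> \<alpha>\<^sub>A q2)
    + Q y \<star> (\<lambda>q1 q2. \<alpha>\<^sub>A q1 \<otimes>\<^bsub>AA\<^esub> (\<alpha>\<^sub>H x \<triangleright> q2))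
    - Q x \<star> (\<lambda>q1 q2. \<alpha>\<^sub>A q1 \<otimes>\<^bsub>AA\<^esub> (\<alpha>\<^sub>H y \<triangleright> q2))
    - Q x \<star> (\<lambda>q1 q2. (\<alpha>\<^sub>H y \<triangleright> q1) \<otimes>\<^bsub>AA\<^esub> \<alpha>\<^sub>A q2))"

definition TLB3 :: bool where
  "TLB3 \<longleftrightarrow> (\<forall>a b.
    \<delta>\<^sub>A \<lbrakk>a, b\<rbrakk>\<^sub>A + Q (\<theta> a b)
    = bracket_left sA \<alpha>\<^sub>A (bracketA D) (\<alpha>\<^sub>A a) (\<delta>\<^sub>A b)
    + bracket_right sA \<alpha>\<^sub>A (bracketA D) (\<delta>\<^sub>A a) (\<alpha>\<^sub>A b)
    - \<phi> b \<star> (\<lambda>bm b0. (bm \<triangleright> \<alpha>\<^sub>A a) \<otimes>\<^bsub>AA\<^esub> \<alpha>\<^sub>A b0)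
    - \<phi> a \<star> (\<lambda>am a0. \<alpha>\<^sub>A a0 \<otimes>\<^bsub>AA\<^esub> (am \<triangleright> \<alpha>\<^sub>A b))
    + \<phi> a \<star> (\<lambda>am a0. (am \<triangleright> \<alpha>\<^sub>A b) \<otimes>\<^bsub>AA\<^esub> \<alpha>\<^sub>A a0)
    + \<phi> b \<star> (\<lambda>bm b0. \<alpha>\<^sub>A b0 \<otimes>\<^bsub>AA\<^esub> (bm \<triangleright> \<alpha>\<^sub>A a)))"

definition TLB4 :: bool where
  "TLB4 \<longleftrightarrow> (\<forall>x y.
    \<delta>\<^sub>H \<lbrakk>x, y\<rbrakk>\<^sub>H + P (\<sigma> x y)
    = bracket_right sH \<alpha>\<^sub>H (bracketH D) (\<delta>\<^sub>H x) (\<alpha>\<^sub>H y)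
    + bracket_left sH \<alpha>\<^sub>H (bracketH D) (\<alpha>\<^sub>H x) (\<delta>\<^sub>H y)
    - \<psi> x \<star> (\<lambda>x0 xp. \<alpha>\<^sub>H x0 \<otimes>\<^bsub>HH\<^esub> (\<alpha>\<^sub>H y \<triangleleft> xp))
    - \<psi> y \<star> (\<lambda>y0 yp. (\<alpha>\<^sub>H x \<triangleleft> yp) \<otimes>\<^bsub>HH\<^esub> \<alpha>\<^sub>H y0)
    + \<psi> y \<star> (\<lambda>y0 yp. \<alpha>\<^sub>H y0 \<otimes>\<^bsub>HH\<^esub> (\<alpha>\<^sub>H x \<triangleleft> yp))
    + \<psi> x \<star> (\<lambda>x0 xp. (\<alpha>\<^sub>H y \<triangleleft> xp) \<otimes>\<^bsub>HH\<^esub> \<alpha>\<^sub>H x0))"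

definition TYD :: bool where
  "TYD \<longleftrightarrow> (\<forall>a x.
    \<phi> (x \<triangleright> a) + \<psi> (x \<triangleleft> a)
    = \<phi> a \<star> (\<lambda>am a0. \<lbrakk>\<alpha>\<^sub>H x, am\<rbrakk>\<^sub>H \<otimes>\<^bsub>HA\<^esub> \<alpha>\<^sub>A a0)
    + \<phi> a \<star> (\<lambda>am a0. \<alpha>\<^sub>H am \<otimes>\<^bsub>HA\<^esub> (\<alpha>\<^sub>H x \<triangleright> a0))
    + \<delta>\<^sub>H x \<star> (\<lambda>x1 x2. \<alpha>\<^sub>H x1 \<otimes>\<^bsub>HA\<^esub> (x2 \<triangleright> \<alpha>\<^sub>A a))
    + \<psi> x \<star> (\<lambda>x0 xp. \<alpha>\<^sub>H x0 \<otimes>\<^bsub>HA\<^esub> \<lbrakk>xp, \<alpha>\<^sub>A a\<rbrakk>\<^sub>A)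
    + \<psi> x \<star> (\<lambda>x0 xp. (x0 \<triangleleft> \<alpha>\<^sub>A a) \<otimes>\<^bsub>HA\<^esub> \<alpha>\<^sub>A xp)
    + \<delta>\<^sub>A a \<star> (\<lambda>a1 a2. (\<alpha>\<^sub>H x \<triangleleft> a1) \<otimes>\<^bsub>HA\<^esub> \<alpha>\<^sub>A a2)
    + P a \<star> (\<lambda>p1 p2. \<alpha>\<^sub>H p1 \<otimes>\<^bsub>HA\<^esub> \<sigma> (\<alpha>\<^sub>H x) p2)
    + Q x \<star> (\<lambda>q1 q2. \<theta> q1 (\<alpha>\<^sub>A a) \<otimes>\<^bsub>HA\<^esub> \<alpha>\<^sub>A q2))"

subsection \<open>The structure on the direct sum\<close>

definition scaleE :: "'k \<Rightarrow> 'a \<times> 'h \<Rightarrow> 'a \<times> 'h" where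
  "scaleE = module_prod.scale sA sH"

definition alphaE :: "'a \<times> 'h \<Rightarrow> 'a \<times> 'h" where
  "alphaE = map_prod \<alpha>\<^sub>A \<alpha>\<^sub>H"

definition bracketE :: "'a \<times> 'h \<Rightarrow> 'a \<times> 'h \<Rightarrow> 'a \<times> 'h" where
  "bracketE = (\<lambda>(a, x) (b, y).
    (\<lbrakk>a, b\<rbrakk>\<^sub>A + x \<triangleright> b - y \<triangleright> a + \<sigma> x y, \<lbrakk>x, y\<rbrakk>\<^sub>H + x \<triangleleft> b - y \<triangleleft> a + \<theta> a b))"

text \<open>The maps on tensor products induced by the inclusions of \<open>A\<close> and \<open>H\<close> into the direct sum;
  \<open>\<tau>\<phi>(a)\<close> and \<open>\<tau>\<psi>(x)\<close> lie in \<open>A \<otimes> H\<close>.\<close>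

definition inclAA :: "('k, 'a, 'a) tensor2 \<Rightarrow> ('k, 'a \<times> 'h, 'a \<times> 'h) tensor2" where
  "inclAA t = t \<star> (\<lambda>a b. tens scaleE scaleE (a, 0) (b, 0))"

definition inclHA :: "('k, 'h, 'a) tensor2 \<Rightarrow> ('k, 'a \<times> 'h, 'a \<times> 'h) tensor2" where
  "inclHA t = t \<star> (\<lambda>x b. tens scaleE scaleE (0, x) (b, 0))"

definition inclAH :: "('k, 'a, 'h) tensor2 \<Rightarrow> ('k, 'a \<times> 'h, 'a \<times> 'h) tensor2" where
  "inclAH t = t \<star> (\<lambda>a y. tens scaleE scaleE (a, 0) (0, y))"

definition inclHH :: "('k, 'h, 'h) tensor2 \<Rightarrow> ('k, 'a \<times> 'h, 'a \<times> 'h) tensor2" where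
  "inclHH t = t \<star> (\<lambda>x y. tens scaleE scaleE (0, x) (0, y))"

definition cobracketE :: "'a \<times> 'h \<Rightarrow> ('k, 'a \<times> 'h, 'a \<times> 'h) tensor2" where
  "cobracketE = (\<lambda>(a, x).
    (inclAA (\<delta>\<^sub>A a) + inclHA (\<phi> a) - inclAH (tau (\<phi> a)) + inclHH (P a)) +
    (inclHH (\<delta>\<^sub>H x) + inclHA (\<psi> x) - inclAH (tau (\<psi> x)) + inclAA (Q x)))"

end

locale hom_pair = hom_datum +
  assumes hom_vector_space_A: "hom_vector_space sA \<alpha>\<^sub>A"
    and hom_vector_space_H: "hom_vector_space sH \<alpha>\<^sub>H"
    and bilinear_bracketA: "bilinear_map sA sA sA (bracketA D)"
    and bilinear_bracketH: "bilinear_map sH sH sH (bracketH D)"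
    and antisymmetric_bracketA: "antisymmetric (bracketA D)"
    and antisymmetric_bracketH: "antisymmetric (bracketH D)"
    and linear_cobracketA: "linear_to_tensor sA sA sA \<delta>\<^sub>A"
    and linear_cobracketH: "linear_to_tensor sH sH sH \<delta>\<^sub>H"
    and co_antisymmetric_cobracketA: "co_antisymmetric \<delta>\<^sub>A"
    and co_antisymmetric_cobracketH: "co_antisymmetric \<delta>\<^sub>H"
    and bilinear_left_action: "bilinear_map sH sA sA (\<triangleright>)"
    and bilinear_right_action: "bilinear_map sH sA sH (\<triangleleft>)"
    and bilinear_sigma: "bilinear_map sH sH sA \<sigma>"
    and bilinear_theta: "bilinear_map sA sA sH \<theta>"
    and linear_phi: "linear_to_tensor sA sH sA \<phi>"
    and linear_psi: "linear_to_tensor sH sH sA \<psi>"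
    and linear_P: "linear_to_tensor sA sH sH P"
    and linear_Q: "linear_to_tensor sH sA sA Q"

end

(*
  Tensors are functionals on bilinear forms, so every identity between tensors is checked by
  evaluating it on a bilinear or trilinear form, and a form on A + H splits into its restrictions to
  the summands.  The Jacobi sum is invariant under cyclic rotation, so only arguments of the types
  AAA, HAA, HHA and HHH matter; these are the axioms of a cocycle cross product system.
  Antisymmetry of the cobracket puts the coalgebra identity into the same cyclic form, and its four
  types are the axioms of a cycle cross coproduct system.  In the compatibility condition both sides
  are bilinear, antisymmetric in the arguments and antisymmetric tensors, so it is equivalent to its
  AA, HA and HH components for the argument types AA, HA and HH: these are the nine equations.
*)

theory Submission
  imports Defs
begin

section \<open>Multilinear maps\<close>

text \<open>Tensors are functionals on all functions of two or three arguments, extended by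
  \<open>0\<close> off multilinear forms, and they are additive only on forms. Two duties therefore
  recur. To prove that two tensors are equal, both sides must also be seen to vanish off forms; and
  before a sum under a functional is split, each summand must be known to be a form. The second duty
  is serious for nested co-operations, where the inner value has to be a form in the outer
  variables. Changes of sign and swaps of antisymmetric factors are exempt, since they hold at every
  function. Most computations rest on \<open>tensor_functional\<close> alone; membership in the span
  of pure tensors matters only when the cobracket on the sum is shown to take values in the tensor
  product. A component of a tensor over \<open>A + H\<close> is read off by evaluating at a form
  pulled back along \<open>fst\<close> and \<open>snd\<close>; conversely a form on the sum is
  restricted along \<open>(a, 0)\<close> and \<open>(0, x)\<close>, and pulling the restriction back
  gives one summand of the form.\<close>

abbreviation bilinear_form where "bilinear_form s1 s2 B \<equiv> bilinear_map s1 s2 (*) B"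
abbreviation trilinear_form where "trilinear_form s1 s2 s3 B \<equiv> trilinear_map s1 s2 s3 (*) B"

lemma linear_zero_map:
  "vector_space s1 \<Longrightarrow> vector_space s2 \<Longrightarrow> Vector_Spaces.linear s1 s2 (\<lambda>u. 0)"
  by (simp add: Vector_Spaces.linear_iff module.scale_zero_right[OF module_iff_vector_space[THEN iffD2]])

lemma linear_identity: "vector_space s \<Longrightarrow> Vector_Spaces.linear s s (\<lambda>u. u)"
  by (simp add: Vector_Spaces.linear_iff)

lemma linear_add_maps:
  "Vector_Spaces.linear s1 s2 f \<Longrightarrow> Vector_Spaces.linear s1 s2 g
    \<Longrightarrow> Vector_Spaces.linear s1 s2 (\<lambda>u. f u + g u)"
  by (simp add: Vector_Spaces.linear_iff)
    (simp add: vector_space.vector_space_assms(1) add_ac)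

lemma linear_minus_map:
  assumes "Vector_Spaces.linear s1 s2 f"
  shows "Vector_Spaces.linear s1 s2 (\<lambda>u. - f u)"
proof -
  interpret Vector_Spaces.linear s1 s2 f by fact
  show ?thesis using assms by (simp add: Vector_Spaces.linear_iff add scale)
qed

lemma linear_diff_maps:
  "Vector_Spaces.linear s1 s2 f \<Longrightarrow> Vector_Spaces.linear s1 s2 g
    \<Longrightarrow> Vector_Spaces.linear s1 s2 (\<lambda>u. f u - g u)"
  using linear_add_maps[OF _ linear_minus_map, of s1 s2 f g] by simp

lemma linear_scaled_form:
  "Vector_Spaces.linear s (*) f \<Longrightarrow> Vector_Spaces.linear s (*) (\<lambda>u. c * f u)"
  by (simp add: Vector_Spaces.linear_iff algebra_simps)

lemma bilinear_linear_left:
  "bilinear_map s1 s2 s f \<Longrightarrow> Vector_Spaces.linear r s1 g \<Longrightarrow> Vector_Spaces.linear r s (\<lambda>u. f (g u) v)"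
  unfolding bilinear_map_def by (rule linear_comp) auto

lemma bilinear_linear_right:
  "bilinear_map s1 s2 s f \<Longrightarrow> Vector_Spaces.linear r s2 g \<Longrightarrow> Vector_Spaces.linear r s (\<lambda>v. f u (g v))"
  unfolding bilinear_map_def by (rule linear_comp) auto

lemma trilinear_linear1:
  "trilinear_map s1 s2 s3 s f \<Longrightarrow> Vector_Spaces.linear r s1 g
    \<Longrightarrow> Vector_Spaces.linear r s (\<lambda>u. f (g u) v w)"
  unfolding trilinear_map_def by (rule linear_comp) auto

lemma trilinear_linear2:
  "trilinear_map s1 s2 s3 s f \<Longrightarrow> Vector_Spaces.linear r s2 g
    \<Longrightarrow> Vector_Spaces.linear r s (\<lambda>v. f u (g v) w)"
  unfolding trilinear_map_def by (rule linear_comp) auto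

lemma trilinear_linear3:
  "trilinear_map s1 s2 s3 s f \<Longrightarrow> Vector_Spaces.linear r s3 g
    \<Longrightarrow> Vector_Spaces.linear r s (\<lambda>w. f u v (g w))"
  unfolding trilinear_map_def by (rule linear_comp) auto

lemma bilinear_mapI:
  "(\<And>v. Vector_Spaces.linear s1 s (\<lambda>u. f u v)) \<Longrightarrow> (\<And>u. Vector_Spaces.linear s2 s (\<lambda>v. f u v))
    \<Longrightarrow> bilinear_map s1 s2 s f"
  by (simp add: bilinear_map_def)

lemma trilinear_mapI:
  "(\<And>v w. Vector_Spaces.linear s1 s (\<lambda>u. f u v w)) \<Longrightarrow> (\<And>u w. Vector_Spaces.linear s2 s (\<lambda>v. f u v w))
    \<Longrightarrow> (\<And>u v. Vector_Spaces.linear s3 s (\<lambda>w. f u v w)) \<Longrightarrow> trilinear_map s1 s2 s3 s f"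
  by (simp add: trilinear_map_def)

lemma bilinear_map_add:
  assumes "bilinear_map s1 s2 s f"
  shows "f (u + u') v = f u v + f u' v" "f u (v + v') = f u v + f u v'"
  using assms by (simp_all add: bilinear_map_def Vector_Spaces.linear_iff)

lemma bilinear_map_zero:
  assumes "bilinear_map s1 s2 s f"
  shows "f 0 v = 0" "f u 0 = 0" "f 0 = (\<lambda>v. 0)"
proof -
  show *: "f 0 v = 0" for v using bilinear_map_add(1)[OF assms, of 0 0 v] by simp
  show "f u 0 = 0" using bilinear_map_add(2)[OF assms, of u 0 0] by simp
  show "f 0 = (\<lambda>v. 0)" using * by blast
qed

lemma bilinear_map_minus:
  assumes "bilinear_map s1 s2 s f"
  shows "f (- u) v = - f u v" "f u (- v) = - f u v"
  using bilinear_map_add(1)[OF assms, of u "- u" v] bilinear_map_add(2)[OF assms, of u v "- v"]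
  by (simp_all add: bilinear_map_zero[OF assms] eq_neg_iff_add_eq_0 add.commute)

lemma trilinear_map_add:
  assumes "trilinear_map s1 s2 s3 s f"
  shows "f (u + u') v w = f u v w + f u' v w" "f u (v + v') w = f u v w + f u v' w"
    "f u v (w + w') = f u v w + f u v w'"
  using assms by (simp_all add: trilinear_map_def Vector_Spaces.linear_iff)

text \<open>The last two laws are equations between functions because forms under a functional are
  eta-contracted: \<open>\<lambda>v w. f 0 v w\<close> becomes \<open>f 0\<close>, where a law with
  all three arguments does not match.\<close>

lemma trilinear_map_zero:
  assumes "trilinear_map s1 s2 s3 s f"
  shows "f u v 0 = 0" "f u 0 = (\<lambda>w. 0)" "f 0 = (\<lambda>v w. 0)"
proof -
  have "f 0 v w = 0" "f u 0 w = 0" "f u v 0 = 0" for u v w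
    using trilinear_map_add(1)[OF assms, of 0 0 v w] trilinear_map_add(2)[OF assms, of u 0 0 w]
      trilinear_map_add(3)[OF assms, of u v 0 0] by simp_all
  then show "f u v 0 = 0" "f u 0 = (\<lambda>w. 0)" "f 0 = (\<lambda>v w. 0)" by (simp_all add: fun_eq_iff)
qed

lemma bilinear_form_swap:
  "bilinear_map s1 s2 s B \<Longrightarrow> bilinear_map s2 s1 s (\<lambda>u v. B v u)"
  by (simp add: bilinear_map_def)

lemma bilinear_form_add:
  "bilinear_form s1 s2 B \<Longrightarrow> bilinear_form s1 s2 C \<Longrightarrow> bilinear_form s1 s2 (\<lambda>u v. B u v + C u v)"
  by (simp add: bilinear_map_def linear_add_maps)

lemma bilinear_form_scaled:
  "bilinear_form s1 s2 B \<Longrightarrow> bilinear_form s1 s2 (\<lambda>u v. c * B u v)"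
  by (simp add: bilinear_map_def linear_scaled_form)

section \<open>Tensors as functionals on bilinear forms\<close>

text \<open>The linear functionals on the space of bilinear forms, extended by \<open>0\<close>.
  They form the double dual of the tensor product, which in infinite dimension is larger than
  \<open>tensor_space\<close>, but it still has all the rules needed for evaluation.\<close>

definition tensor_functional ::
  "('k::field \<Rightarrow> 'u::ab_group_add \<Rightarrow> 'u) \<Rightarrow> ('k \<Rightarrow> 'v::ab_group_add \<Rightarrow> 'v)
    \<Rightarrow> ('k, 'u, 'v) tensor2 \<Rightarrow> bool" where
  "tensor_functional s1 s2 t \<longleftrightarrow>
    (\<forall>B. \<not> bilinear_form s1 s2 B \<longrightarrow> t B = 0) \<and>
    (\<forall>B C. bilinear_form s1 s2 B \<longrightarrow> bilinear_form s1 s2 C \<longrightarrow> t (\<lambda>u v. B u v + C u v) = t B + t C) \<and>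
    (\<forall>c B. bilinear_form s1 s2 B \<longrightarrow> t (\<lambda>u v. c * B u v) = c * t B)"

lemma tensor_functional_tens: "tensor_functional s1 s2 (tens s1 s2 u v)"
  by (auto simp: tensor_functional_def tens_def bilinear_form_add bilinear_form_scaled)

lemma tensor_functional_zero: "tensor_functional s1 s2 0"
  by (simp add: tensor_functional_def)

lemma tensor_functional_add:
  "tensor_functional s1 s2 t \<Longrightarrow> tensor_functional s1 s2 t' \<Longrightarrow> tensor_functional s1 s2 (t + t')"
  by (simp add: tensor_functional_def algebra_simps)

lemma tensor_functional_scale:
  "tensor_functional s1 s2 t \<Longrightarrow> tensor_functional s1 s2 (fun_scale c t)"
  by (simp add: tensor_functional_def fun_scale_def algebra_simps)

lemma tensor_space_functional:
  fixes s1 :: "'k::field \<Rightarrow> 'u::ab_group_add \<Rightarrow> 'u" and s2 :: "'k \<Rightarrow> 'v::ab_group_add \<Rightarrow> 'v"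
  assumes "t \<in> tensor_space s1 s2"
  shows "tensor_functional s1 s2 t"
proof -
  interpret vector_space "fun_scale :: 'k \<Rightarrow> ('k, 'u, 'v) tensor2 \<Rightarrow> _"
    by (rule vector_space_fun_scale)
  have "subspace {t. tensor_functional s1 s2 t}"
    by (simp add: subspace_def tensor_functional_zero tensor_functional_add tensor_functional_scale)
  then have "tensor_space s1 s2 \<subseteq> {t. tensor_functional s1 s2 t}"
    unfolding tensor_space_def by (intro span_minimal) (auto simp: tensor_functional_tens)
  then show ?thesis using assms by blast
qed

lemma tensor_functional_outside: "tensor_functional s1 s2 t \<Longrightarrow> \<not> bilinear_form s1 s2 B \<Longrightarrow> t B = 0"
  by (simp add: tensor_functional_def)

lemma tensor_functional_sum:
  "tensor_functional s1 s2 t \<Longrightarrow> bilinear_form s1 s2 B \<Longrightarrow> bilinear_form s1 s2 C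
    \<Longrightarrow> t (\<lambda>u v. B u v + C u v) = t B + t C"
  by (simp add: tensor_functional_def)

lemma tensor_functional_scaled:
  "tensor_functional s1 s2 t \<Longrightarrow> bilinear_form s1 s2 B \<Longrightarrow> t (\<lambda>u v. c * B u v) = c * t B"
  by (simp add: tensor_functional_def)

text \<open>If \<open>s1\<close> or \<open>s2\<close> is not a vector space, the zero function is
  not a form; then the guard gives \<open>0\<close>. Otherwise it is \<open>0\<close> times
  itself.\<close>

lemma tensor_functional_null:
  assumes "tensor_functional s1 s2 t"
  shows "t (\<lambda>u v. 0) = 0"
proof (cases "bilinear_form s1 s2 (\<lambda>u v. 0)")
  case True
  then show ?thesis using tensor_functional_scaled[OF assms True, of 0] by simp
qed (use tensor_functional_outside[OF assms] in blast)

text \<open>No bilinearity is asked of \<open>B\<close>: if \<open>B\<close> is not a form, neither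
  is its negative, and both values are the guard value. Signs can thus be moved by plain
  rewriting.\<close>

lemma tensor_functional_minus:
  assumes "tensor_functional s1 s2 t"
  shows "t (\<lambda>u v. - B u v) = - t B"
proof (cases "bilinear_form s1 s2 B")
  case True
  then show ?thesis using tensor_functional_scaled[OF assms True, of "-1"] by simp
next
  case False
  then have "\<not> bilinear_form s1 s2 (\<lambda>u v. - B u v)"
    using bilinear_form_scaled[of s1 s2 "\<lambda>u v. - B u v" "-1"] by auto
  then show ?thesis using False tensor_functional_outside[OF assms] by simp
qed

lemma tensor_functional_eqI:
  assumes "tensor_functional s1 s2 t" "tensor_functional s1 s2 t'"
    and "\<And>B. bilinear_form s1 s2 B \<Longrightarrow> t B = t' B"
  shows "t = t'"
  using assms by (intro ext) (metis tensor_functional_outside)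

text \<open>Serves nested evaluations: the value of an inner functional must be linear in an outer
  variable that occurs in its argument.\<close>

lemma tensor_functional_linear:
  assumes "tensor_functional s1 s2 t" "vector_space s"
    and "\<And>w. bilinear_form s1 s2 (\<lambda>u v. C w u v)"
    and "\<And>u v. Vector_Spaces.linear s (*) (\<lambda>w. C w u v)"
  shows "Vector_Spaces.linear s (*) (\<lambda>w. t (\<lambda>u v. C w u v))"
proof -
  have "C (w + w') = (\<lambda>u v. C w u v + C w' u v)" "C (s c w) = (\<lambda>u v. c * C w u v)" for w w' c
    using assms(4) by (simp_all add: Vector_Spaces.linear_iff fun_eq_iff)
  then show ?thesis
    using assms(2) unfolding Vector_Spaces.linear_iff
    by (simp only: vector_space_field tensor_functional_sum[OF assms(1,3,3)]
        tensor_functional_scaled[OF assms(1,3)] simp_thms)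
qed

lemma linear_to_tensor_mem: "linear_to_tensor s s1 s2 f \<Longrightarrow> f x \<in> tensor_space s1 s2"
  by (auto simp: linear_to_tensor_def)

lemma linear_to_tensor_functional:
  "linear_to_tensor s s1 s2 f \<Longrightarrow> tensor_functional s1 s2 (f x)"
  by (rule tensor_space_functional[OF linear_to_tensor_mem])

lemma linear_to_tensor_linear:
  assumes "linear_to_tensor s s1 s2 f" "Vector_Spaces.linear r s g"
  shows "Vector_Spaces.linear r (*) (\<lambda>x. f (g x) B)"
proof -
  have "Vector_Spaces.linear s fun_scale f" using assms(1) by (simp add: linear_to_tensor_def)
  then show ?thesis by (rule linear_comp[OF linear_comp[OF assms(2)] linear_evaluation])
qed

lemma linear_to_tensor_add:
  "linear_to_tensor s s1 s2 f \<Longrightarrow> f (x + y) = f x + f y"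
  by (simp add: linear_to_tensor_def Vector_Spaces.linear_iff)

lemma linear_to_tensor_zero: "linear_to_tensor s s1 s2 f \<Longrightarrow> f 0 = 0"
  using linear_to_tensor_add[of s s1 s2 f 0 0] by (metis add_0 add_right_cancel)

lemma linear_to_tensor_minus: "linear_to_tensor s s1 s2 f \<Longrightarrow> f (- x) = - f x"
  using linear_to_tensor_add[of s s1 s2 f x "- x"] linear_to_tensor_zero[of s s1 s2 f]
  by (metis add.right_inverse minus_unique)

lemma sweedler_tensor_functional:
  assumes "tensor_functional s1 s2 t" "bilinear_map s1 s2 fun_scale f"
    and "\<And>u v. tensor_functional r1 r2 (f u v)"
  shows "tensor_functional r1 r2 (t \<star> f)"
proof -
  have f: "bilinear_form s1 s2 (\<lambda>u v. f u v B)" for B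
    using assms(2) unfolding bilinear_map_def by (auto intro: linear_comp[OF _ linear_evaluation, of _ _ B])
  show ?thesis
    unfolding tensor_functional_def sweedler_def
    using assms(3) f
    by (intro conjI allI impI)
      (simp_all add: tensor_functional_def tensor_functional_null[OF assms(1)]
        tensor_functional_sum[OF assms(1)] tensor_functional_scaled[OF assms(1)])
qed

lemma sweedler_apply: "(t \<star> f) B = t (\<lambda>u v. f u v B)"
  by (simp add: sweedler_def)

lemma tens_apply: "bilinear_form s1 s2 B \<Longrightarrow> tens s1 s2 u v B = B u v"
  by (simp add: tens_def)

lemma tens_apply_outside: "\<not> bilinear_form s1 s2 B \<Longrightarrow> tens s1 s2 u v B = 0"
  by (simp add: tens_def)

lemma tens_left_apply:
  "trilinear_form s1 s2 s3 B \<Longrightarrow> tens_left s1 s2 s3 u t B = t (\<lambda>v w. B u v w)"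
  by (simp add: tens_left_def sweedler_def tens3_def)

lemma tens_right_apply:
  "trilinear_form s1 s2 s3 B \<Longrightarrow> tens_right s1 s2 s3 t w B = t (\<lambda>u v. B u v w)"
  by (simp add: tens_right_def sweedler_def tens3_def)

lemma tens_left_apply_outside:
  "\<not> trilinear_form s1 s2 s3 B \<Longrightarrow> tensor_functional s2 s3 t \<Longrightarrow> tens_left s1 s2 s3 u t B = 0"
  by (simp add: tens_left_def sweedler_def tens3_def tensor_functional_null)

lemma tens_right_apply_outside:
  "\<not> trilinear_form s1 s2 s3 B \<Longrightarrow> tensor_functional s1 s2 t \<Longrightarrow> tens_right s1 s2 s3 t w B = 0"
  by (simp add: tens_right_def sweedler_def tens3_def tensor_functional_null)

lemma tau_apply: "tau t B = t (\<lambda>u v. B v u)"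
  by (simp add: tau_def)

lemma tau12_apply: "tau12 t B = t (\<lambda>u v w. B v u w)"
  by (simp add: tau12_def)

lemma tau23_apply: "tau23 t B = t (\<lambda>u v w. B u w v)"
  by (simp add: tau23_def)

lemma Cyc_apply: "Cyc t B = t B + t (\<lambda>u v w. B w u v) + t (\<lambda>u v w. B v w u)"
  by (simp add: Cyc_def tau12_def tau23_def)

lemma trilinear_form_add:
  "trilinear_form s1 s2 s3 B \<Longrightarrow> trilinear_form s1 s2 s3 C
    \<Longrightarrow> trilinear_form s1 s2 s3 (\<lambda>u v w. B u v w + C u v w)"
  by (simp add: trilinear_map_def linear_add_maps)

lemma trilinear_form_swap12: "trilinear_map s1 s2 s3 s B \<Longrightarrow> trilinear_map s2 s1 s3 s (\<lambda>u v w. B v u w)"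
  by (simp add: trilinear_map_def)

lemma trilinear_form_swap23: "trilinear_map s1 s2 s3 s B \<Longrightarrow> trilinear_map s1 s3 s2 s (\<lambda>u v w. B u w v)"
  by (simp add: trilinear_map_def)

lemma trilinear_form_rotate:
  assumes "trilinear_map s1 s2 s3 s B"
  shows "trilinear_map s2 s3 s1 s (\<lambda>u v w. B w u v)" "trilinear_map s3 s1 s2 s (\<lambda>u v w. B v w u)"
  using assms by (simp_all add: trilinear_map_def)

lemma trilinear_bilinear1:
  assumes "trilinear_map s1 s2 s3 s B"
  shows "bilinear_map s2 s3 s (\<lambda>v w. B u v w)"
  using assms by (simp add: trilinear_map_def bilinear_map_def)

text \<open>Valid at every function \<open>B\<close>, form or not, because equality of tensors is
  equality of functions. Later swaps of tensor factors hence carry no side condition.\<close>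

lemma co_antisymmetric_apply: "co_antisymmetric f \<Longrightarrow> f x B = - f x (\<lambda>u v. B v u)"
  unfolding co_antisymmetric_def by (metis tau_apply uminus_apply)

text \<open>The preimage of a subspace under the linear map \<open>t \<mapsto> t \<star> f\<close>
  is a subspace, and by \<open>sweedler_tens\<close> it contains the pure tensors.\<close>

lemma sweedler_tensor_space:
  fixes s1 :: "'k::field \<Rightarrow> 'u::ab_group_add \<Rightarrow> 'u" and s2 :: "'k \<Rightarrow> 'v::ab_group_add \<Rightarrow> 'v"
    and r1 :: "'k \<Rightarrow> 'x::ab_group_add \<Rightarrow> 'x" and r2 :: "'k \<Rightarrow> 'y::ab_group_add \<Rightarrow> 'y"
  assumes "t \<in> tensor_space s1 s2" and f: "bilinear_map s1 s2 fun_scale f"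
    and mem: "\<And>u v. f u v \<in> tensor_space r1 r2"
  shows "t \<star> f \<in> tensor_space r1 r2"
proof -
  interpret vs1: vector_space "fun_scale :: 'k \<Rightarrow> ('k, 'u, 'v) tensor2 \<Rightarrow> _"
    by (rule vector_space_fun_scale)
  interpret vs2: vector_space "fun_scale :: 'k \<Rightarrow> ('k, 'x, 'y) tensor2 \<Rightarrow> _"
    by (rule vector_space_fun_scale)
  have sub: "vs2.subspace (tensor_space r1 r2)"
    unfolding tensor_space_def by (rule vs2.subspace_span)
  have "vs1.subspace {t. t \<star> f \<in> tensor_space r1 r2}"
  proof (unfold vs1.subspace_def, safe)
    have "(0 :: ('k, 'u, 'v) tensor2) \<star> f = 0" by (simp add: sweedler_def fun_eq_iff)
    then show "(0 :: ('k, 'u, 'v) tensor2) \<star> f \<in> tensor_space r1 r2"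
      using vs2.subspace_0[OF sub] by simp
  next
    fix t t' :: "('k, 'u, 'v) tensor2"
    assume "t \<star> f \<in> tensor_space r1 r2" "t' \<star> f \<in> tensor_space r1 r2"
    moreover have "(t + t') \<star> f = t \<star> f + t' \<star> f" by (simp add: sweedler_def fun_eq_iff)
    ultimately show "(t + t') \<star> f \<in> tensor_space r1 r2"
      using vs2.subspace_add[OF sub] by simp
  next
    fix c :: 'k and t :: "('k, 'u, 'v) tensor2"
    assume "t \<star> f \<in> tensor_space r1 r2"
    moreover have "fun_scale c t \<star> f = fun_scale c (t \<star> f)"
      by (simp add: sweedler_def fun_scale_def fun_eq_iff)
    ultimately show "fun_scale c t \<star> f \<in> tensor_space r1 r2"
      using vs2.subspace_scale[OF sub] by simp
  qed
  then have "tensor_space s1 s2 \<subseteq> {t. t \<star> f \<in> tensor_space r1 r2}"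
    unfolding tensor_space_def[of s1 s2]
    by (intro vs1.span_minimal) (auto simp: sweedler_tens[OF f] mem)
  then show ?thesis using assms(1) by blast
qed

lemma tens_in_tensor_space: "tens s1 s2 u v \<in> tensor_space s1 s2"
  unfolding tensor_space_def by (rule module.span_base) (auto intro: vector_space_fun_scale module_iff_vector_space[THEN iffD2])

lemma tensor_space_add:
  "t \<in> tensor_space s1 s2 \<Longrightarrow> t' \<in> tensor_space s1 s2 \<Longrightarrow> t + t' \<in> tensor_space s1 s2"
  unfolding tensor_space_def by (rule module.span_add[OF module_iff_vector_space[THEN iffD2, OF vector_space_fun_scale]])

lemma tensor_space_diff:
  "t \<in> tensor_space s1 s2 \<Longrightarrow> t' \<in> tensor_space s1 s2 \<Longrightarrow> t - t' \<in> tensor_space s1 s2"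
  unfolding tensor_space_def by (rule module.span_diff[OF module_iff_vector_space[THEN iffD2, OF vector_space_fun_scale]])

section \<open>The coalgebra identity in cyclic form\<close>

text \<open>The value of \<open>(\<alpha> \<otimes> \<delta>)\<delta>(x)\<close> at
  \<open>B\<close>, written as a bare nested evaluation without the guard for functions that are not
  trilinear.\<close>

definition iterated_cobracket ::
  "('v \<Rightarrow> 'v) \<Rightarrow> ('v \<Rightarrow> ('k, 'v, 'v) tensor2) \<Rightarrow> 'v \<Rightarrow> ('v \<Rightarrow> 'v \<Rightarrow> 'v \<Rightarrow> 'k::field) \<Rightarrow> 'k" where
  "iterated_cobracket \<alpha> \<delta> x B = \<delta> x (\<lambda>x1 x2. \<delta> x2 (\<lambda>v w. B (\<alpha> x1) v w))"

definition co_jacobiator ::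
  "('v \<Rightarrow> 'v) \<Rightarrow> ('v \<Rightarrow> ('k, 'v, 'v) tensor2) \<Rightarrow> 'v \<Rightarrow> ('v \<Rightarrow> 'v \<Rightarrow> 'v \<Rightarrow> 'k::field) \<Rightarrow> 'k" where
  "co_jacobiator \<alpha> \<delta> x B = iterated_cobracket \<alpha> \<delta> x B
    + iterated_cobracket \<alpha> \<delta> x (\<lambda>u v w. B w u v) + iterated_cobracket \<alpha> \<delta> x (\<lambda>u v w. B v w u)"

lemma co_jacobiator_rotate:
  "co_jacobiator \<alpha> \<delta> x (\<lambda>u v w. B w u v) = co_jacobiator \<alpha> \<delta> x B"
  "co_jacobiator \<alpha> \<delta> x (\<lambda>u v w. B v w u) = co_jacobiator \<alpha> \<delta> x B"
  by (simp_all add: co_jacobiator_def)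

text \<open>By antisymmetry of \<open>\<delta>\<close>, the two terms on the right are minus the rotations of the one on the left.\<close>

lemma co_jacobi_iff:
  assumes \<alpha>: "hom_vector_space s \<alpha>" and \<delta>: "linear_to_tensor s s s \<delta>" and anti: "co_antisymmetric \<delta>"
  shows "\<delta> x \<star> (\<lambda>x1 x2. tens_left s s s (\<alpha> x1) (\<delta> x2)) =
      \<delta> x \<star> (\<lambda>x1 x2. tens_right s s s (\<delta> x1) (\<alpha> x2)) +
      tau12 (\<delta> x \<star> (\<lambda>x1 x2. tens_left s s s (\<alpha> x1) (\<delta> x2)))
    \<longleftrightarrow> (\<forall>B. trilinear_form s s s B \<longrightarrow> co_jacobiator \<alpha> \<delta> x B = 0)" (is "?l = ?r + ?m \<longleftrightarrow> _")
proof -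
  have tf: "tensor_functional s s (\<delta> y)" for y by (rule linear_to_tensor_functional[OF \<delta>])
  have inside: "?l B - ?r B - ?m B = co_jacobiator \<alpha> \<delta> x B" if B: "trilinear_form s s s B" for B
  proof -
    have l: "?l B = iterated_cobracket \<alpha> \<delta> x B"
      by (simp add: sweedler_apply tens_left_apply[OF B] iterated_cobracket_def)
    have "?r B = \<delta> x (\<lambda>x1 x2. \<delta> x1 (\<lambda>v w. B v w (\<alpha> x2)))"
      by (simp add: sweedler_apply tens_right_apply[OF B])
    \<comment> \<open>Antisymmetry of the outer cobracket is used here; for \<open>?m\<close> below
      it is that of the inner one.\<close>
    also have "\<dots> = - iterated_cobracket \<alpha> \<delta> x (\<lambda>u v w. B v w u)"
      unfolding iterated_cobracket_def by (rule co_antisymmetric_apply[OF anti])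
    finally have r: "?r B = \<dots>" .
    have "?m B = \<delta> x (\<lambda>x1 x2. \<delta> x2 (\<lambda>v w. B v (\<alpha> x1) w))"
      by (simp add: tau12_apply sweedler_apply tens_left_apply[OF trilinear_form_swap12[OF B]])
    also have "\<dots> = \<delta> x (\<lambda>x1 x2. - \<delta> x2 (\<lambda>v w. B w (\<alpha> x1) v))"
      by (subst co_antisymmetric_apply[OF anti]) simp
    also have "\<dots> = - iterated_cobracket \<alpha> \<delta> x (\<lambda>u v w. B w u v)"
      by (simp add: tensor_functional_minus[OF tf] iterated_cobracket_def)
    finally show ?thesis using l r by (simp add: co_jacobiator_def)
  qed
  have outside: "?l B = 0" "?r B = 0" "?m B = 0" if B: "\<not> trilinear_form s s s B" for B
  proof -
    \<comment> \<open>\<open>?m\<close> evaluates its argument at \<open>B\<close> with the first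
      two variables exchanged; exchanging them again shows that this is not a form either.\<close>
    have B': "\<not> trilinear_form s s s (\<lambda>u v w. B v u w)"
      using B trilinear_form_swap12[of s s s "(*)" "\<lambda>u v w. B v u w"] by auto
    show "?l B = 0" "?r B = 0" "?m B = 0"
      by (simp_all add: tau12_apply sweedler_apply tens_left_apply_outside[OF B tf]
          tens_right_apply_outside[OF B tf] tens_left_apply_outside[OF B' tf] tensor_functional_null[OF tf])
  qed
  have "?l = ?r + ?m \<longleftrightarrow> (\<forall>B. ?l B - ?r B - ?m B = 0)"
    by (simp add: fun_eq_iff diff_eq_eq add.commute)
  also have "\<dots> \<longleftrightarrow> (\<forall>B. trilinear_form s s s B \<longrightarrow> co_jacobiator \<alpha> \<delta> x B = 0)"
    by (metis inside outside diff_0_right)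
  finally show ?thesis .
qed

lemma bilinear_form_iterated:
  assumes \<alpha>: "hom_vector_space s \<alpha>" and \<delta>: "linear_to_tensor s s s \<delta>"
    and B: "trilinear_form s s s B"
  shows "bilinear_form s s (\<lambda>x1 x2. \<delta> x2 (\<lambda>v w. B (\<alpha> x1) v w))"
proof -
  have vs: "vector_space s" and lin: "Vector_Spaces.linear s s \<alpha>" using \<alpha> by (auto simp: hom_vector_space_def)
  show ?thesis
    by (intro bilinear_mapI linear_to_tensor_linear[OF \<delta>] linear_identity vs lin
        tensor_functional_linear[OF linear_to_tensor_functional[OF \<delta>] vs]
        trilinear_bilinear1[OF B] trilinear_linear1[OF B])
qed

lemma iterated_cobracket_add:
  assumes \<alpha>: "hom_vector_space s \<alpha>" and \<delta>: "linear_to_tensor s s s \<delta>"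
    and B: "trilinear_form s s s B" and C: "trilinear_form s s s C"
  shows "iterated_cobracket \<alpha> \<delta> x (\<lambda>u v w. B u v w + C u v w) =
    iterated_cobracket \<alpha> \<delta> x B + iterated_cobracket \<alpha> \<delta> x C"
proof -
  note tf = linear_to_tensor_functional[OF \<delta>]
  show ?thesis
    unfolding iterated_cobracket_def
    by (simp add: tensor_functional_sum[OF tf trilinear_bilinear1[OF B] trilinear_bilinear1[OF C]]
        tensor_functional_sum[OF tf bilinear_form_iterated[OF \<alpha> \<delta> B] bilinear_form_iterated[OF \<alpha> \<delta> C]])
qed

lemma co_jacobiator_add:
  assumes "hom_vector_space s \<alpha>" "linear_to_tensor s s s \<delta>"
    and "trilinear_form s s s B" "trilinear_form s s s C"
  shows "co_jacobiator \<alpha> \<delta> x (\<lambda>u v w. B u v w + C u v w) =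
    co_jacobiator \<alpha> \<delta> x B + co_jacobiator \<alpha> \<delta> x C"
  unfolding co_jacobiator_def
  by (simp add: iterated_cobracket_add[OF assms] iterated_cobracket_add[OF assms(1,2)
        trilinear_form_rotate(1)[OF assms(3)] trilinear_form_rotate(1)[OF assms(4)]]
      iterated_cobracket_add[OF assms(1,2)
        trilinear_form_rotate(2)[OF assms(3)] trilinear_form_rotate(2)[OF assms(4)]])

section \<open>Compatibility of a bracket and a cobracket at a pair of vectors\<close>

definition compatible where
  "compatible s \<alpha> br \<delta> x y \<longleftrightarrow>
    \<delta> (br x y) = bracket_left s \<alpha> br (\<alpha> x) (\<delta> y) + bracket_right s \<alpha> br (\<delta> x) (\<alpha> y)"

lemma bracket_left_apply:
  assumes "bilinear_form s s B"
  shows "bracket_left s \<alpha> br z t B = t (\<lambda>u v. B (br z u) (\<alpha> v) + B (\<alpha> u) (br z v))"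
  by (simp add: bracket_left_def sweedler_apply tens_apply[OF assms])

lemma bracket_right_apply:
  assumes "bilinear_form s s B"
  shows "bracket_right s \<alpha> br t z B = t (\<lambda>u v. B (br u z) (\<alpha> v) + B (\<alpha> u) (br v z))"
  by (simp add: bracket_right_def sweedler_apply tens_apply[OF assms])

text \<open>Turns the right side of the compatibility condition into a difference of two left
  brackets with exchanged arguments, which makes its antisymmetry visible.\<close>

lemma bracket_right_eq_bracket_left:
  fixes br :: "'v::ab_group_add \<Rightarrow> 'v \<Rightarrow> 'v"
  assumes t: "tensor_functional s s t" and "antisymmetric br"
  shows "bracket_right s \<alpha> br t z = - bracket_left s \<alpha> br z t"
proof
  fix B
  have eq: "br u z = - br z u" for u using assms(2) unfolding antisymmetric_def by blast
  show "bracket_right s \<alpha> br t z B = (- bracket_left s \<alpha> br z t) B"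
  proof (cases "bilinear_form s s B")
    case True
    have "bracket_right s \<alpha> br t z B = t (\<lambda>u v. - (B (br z u) (\<alpha> v) + B (\<alpha> u) (br z v)))"
      by (simp add: bracket_right_apply[OF True] eq bilinear_map_minus[OF True])
    then show ?thesis by (simp only: tensor_functional_minus[OF t] bracket_left_apply[OF True] uminus_apply)
  next
    case False
    then show ?thesis
      by (simp add: bracket_right_def bracket_left_def sweedler_apply tens_apply_outside
          tensor_functional_null[OF t])
  qed
qed

context
  fixes s :: "'k::field \<Rightarrow> 'v::ab_group_add \<Rightarrow> 'v" and \<alpha> br
  assumes \<alpha>: "hom_vector_space s \<alpha>" and br: "bilinear_map s s s br"
begin

lemma bilinear_form_bracket_left:
  assumes "bilinear_form s s B"
  shows "bilinear_form s s (\<lambda>u v. B (br z u) (\<alpha> v))" "bilinear_form s s (\<lambda>u v. B (\<alpha> u) (br z v))"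
proof -
  have lin: "vector_space s" "Vector_Spaces.linear s s \<alpha>" using \<alpha> by (auto simp: hom_vector_space_def)
  show "bilinear_form s s (\<lambda>u v. B (br z u) (\<alpha> v))" "bilinear_form s s (\<lambda>u v. B (\<alpha> u) (br z v))"
    by (intro bilinear_mapI bilinear_linear_left[OF assms] bilinear_linear_right[OF assms]
        bilinear_linear_right[OF br] linear_identity lin)+
qed

lemma bilinear_form_bracket_right:
  assumes "bilinear_form s s B"
  shows "bilinear_form s s (\<lambda>u v. B (br u z) (\<alpha> v))" "bilinear_form s s (\<lambda>u v. B (\<alpha> u) (br v z))"
proof -
  have lin: "vector_space s" "Vector_Spaces.linear s s \<alpha>" using \<alpha> by (auto simp: hom_vector_space_def)
  show "bilinear_form s s (\<lambda>u v. B (br u z) (\<alpha> v))" "bilinear_form s s (\<lambda>u v. B (\<alpha> u) (br v z))"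
    by (intro bilinear_mapI bilinear_linear_left[OF assms] bilinear_linear_right[OF assms]
        bilinear_linear_left[OF br] linear_identity lin)+
qed

lemma bracket_left_form:
  assumes t: "tensor_functional s s t" and B: "bilinear_form s s B"
  shows "bracket_left s \<alpha> br z t B = t (\<lambda>u v. B (br z u) (\<alpha> v)) + t (\<lambda>u v. B (\<alpha> u) (br z v))"
  by (simp add: bracket_left_apply[OF B] tensor_functional_sum[OF t] bilinear_form_bracket_left[OF B])

lemma bracket_right_form:
  assumes t: "tensor_functional s s t" and B: "bilinear_form s s B"
  shows "bracket_right s \<alpha> br t z B = t (\<lambda>u v. B (br u z) (\<alpha> v)) + t (\<lambda>u v. B (\<alpha> u) (br v z))"
  by (simp add: bracket_right_apply[OF B] tensor_functional_sum[OF t] bilinear_form_bracket_right[OF B])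

lemma bracket_left_functional:
  assumes t: "tensor_functional s s t"
  shows "tensor_functional s s (bracket_left s \<alpha> br z t)"
proof -
  have lin: "vector_space s" "Vector_Spaces.linear s s \<alpha>" using \<alpha> by (auto simp: hom_vector_space_def)
  note tens = bilinear_tens[OF lin(1) lin(1)]
  have "bilinear_map s s fun_scale (\<lambda>u v. tens s s (br z u) (\<alpha> v) + tens s s (\<alpha> u) (br z v))"
    by (intro bilinear_mapI linear_add_maps bilinear_linear_left[OF tens] bilinear_linear_right[OF tens]
        bilinear_linear_right[OF br] linear_identity lin)
  then show ?thesis
    unfolding bracket_left_def
    by (intro sweedler_tensor_functional[OF t] tensor_functional_add tensor_functional_tens)
qed

text \<open>The flip of the two factors interchanges the two summands of \<open>[z, t]\<close>, so
  it commutes with \<open>[z, _]\<close> and the antisymmetry of \<open>t\<close> is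
  inherited.\<close>

lemma bracket_left_swap:
  assumes t: "tensor_functional s s t" and swap: "\<And>F. t F = - t (\<lambda>u v. F v u)"
    and B: "bilinear_form s s B"
  shows "bracket_left s \<alpha> br z t (\<lambda>u v. B v u) = - bracket_left s \<alpha> br z t B"
  using swap[of "\<lambda>u v. B (br z u) (\<alpha> v)"] swap[of "\<lambda>u v. B (\<alpha> u) (br z v)"]
  by (simp add: bracket_left_form[OF t B] bracket_left_form[OF t bilinear_form_swap[OF B]])

lemma bracket_left_add:
  assumes t: "tensor_functional s s t"
  shows "bracket_left s \<alpha> br (z + z') t = bracket_left s \<alpha> br z t + bracket_left s \<alpha> br z' t"
proof
  fix B
  show "bracket_left s \<alpha> br (z + z') t B = (bracket_left s \<alpha> br z t + bracket_left s \<alpha> br z' t) B"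
  proof (cases "bilinear_form s s B")
    case True
    note bil = bilinear_form_bracket_left[OF True]
    have "bracket_left s \<alpha> br (z + z') t B = t (\<lambda>u v. (B (br z u) (\<alpha> v) + B (\<alpha> u) (br z v))
        + (B (br z' u) (\<alpha> v) + B (\<alpha> u) (br z' v)))"
      by (simp add: bracket_left_apply[OF True] bilinear_map_add[OF br] bilinear_map_add[OF True] ac_simps)
    then show ?thesis
      by (simp add: bracket_left_apply[OF True] tensor_functional_sum[OF t] bil bilinear_form_add)
  next
    case False
    then show ?thesis
      by (simp add: bracket_left_def sweedler_apply tens_apply_outside tensor_functional_null[OF t])
  qed
qed

context
  fixes \<delta>
  assumes anti: "antisymmetric br" and \<delta>: "linear_to_tensor s s s \<delta>"
begin

text \<open>Exchanging \<open>x\<close> and \<open>y\<close> changes the sign of both sides. With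
  this, additivity in the first argument suffices.\<close>

lemma compatible_sym: "compatible s \<alpha> br \<delta> x y \<Longrightarrow> compatible s \<alpha> br \<delta> y x"
proof -
  assume c: "compatible s \<alpha> br \<delta> x y"
  have "br y x = - br x y" using anti unfolding antisymmetric_def by blast
  then have "\<delta> (br y x) = - \<delta> (br x y)" by (simp add: linear_to_tensor_minus[OF \<delta>])
  then show ?thesis
    using c unfolding compatible_def
    by (simp add: bracket_right_eq_bracket_left[OF linear_to_tensor_functional[OF \<delta>] anti])
qed

lemma compatible_add:
  assumes "compatible s \<alpha> br \<delta> x y" "compatible s \<alpha> br \<delta> x' y"
  shows "compatible s \<alpha> br \<delta> (x + x') y"
proof -
  have "bracket_right s \<alpha> br (\<delta> x + \<delta> x') (\<alpha> y) =
      bracket_right s \<alpha> br (\<delta> x) (\<alpha> y) + bracket_right s \<alpha> br (\<delta> x') (\<alpha> y)"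
    by (simp add: bracket_right_def sweedler_def fun_eq_iff)
  moreover have "\<alpha> (x + x') = \<alpha> x + \<alpha> x'"
    using \<alpha> by (simp add: hom_vector_space_def Vector_Spaces.linear_iff)
  ultimately show ?thesis
    using assms unfolding compatible_def
    by (simp add: bilinear_map_add[OF br] linear_to_tensor_add[OF \<delta>]
        bracket_left_add[OF linear_to_tensor_functional[OF \<delta>]])
qed

end

end

section \<open>The direct sum\<close>

context hom_pair
begin

lemma vector_space_A: "vector_space sA" and linear_alphaA: "Vector_Spaces.linear sA sA \<alpha>\<^sub>A"
  using hom_vector_space_A by (auto simp: hom_vector_space_def)

lemma vector_space_H: "vector_space sH" and linear_alphaH: "Vector_Spaces.linear sH sH \<alpha>\<^sub>H"
  using hom_vector_space_H by (auto simp: hom_vector_space_def)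

sublocale E: vector_space_prod sA sH
  by (intro vector_space_prod.intro vector_space_pair.intro vector_space_A vector_space_H)

lemma vector_space_E: "vector_space scaleE"
  unfolding scaleE_def by (rule E.p.vector_space_axioms)

lemma linear_fst: "Vector_Spaces.linear scaleE sA fst" and linear_snd: "Vector_Spaces.linear scaleE sH snd"
  unfolding scaleE_def by (fact E.linear_fst, fact E.linear_snd)

lemma linear_Pair:
  "Vector_Spaces.linear s sA f \<Longrightarrow> Vector_Spaces.linear s sH g
    \<Longrightarrow> Vector_Spaces.linear s scaleE (\<lambda>u. (f u, g u))"
  by (simp add: Vector_Spaces.linear_iff vector_space_E) (simp add: scaleE_def E.scale_prod)

lemma alphaE_apply: "alphaE u = (\<alpha>\<^sub>A (fst u), \<alpha>\<^sub>H (snd u))"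
  by (simp add: alphaE_def map_prod_def case_prod_beta)

lemma bracketE_apply:
  "bracketE u v = (\<lbrakk>fst u, fst v\<rbrakk>\<^sub>A + snd u \<triangleright> fst v - snd v \<triangleright> fst u + \<sigma> (snd u) (snd v),
    \<lbrakk>snd u, snd v\<rbrakk>\<^sub>H + snd u \<triangleleft> fst v - snd v \<triangleleft> fst u + \<theta> (fst u) (fst v))"
  by (simp add: bracketE_def case_prod_beta)

lemmas bilinear_operations =
  bilinear_bracketA bilinear_bracketH bilinear_left_action bilinear_right_action bilinear_sigma bilinear_theta

lemmas operation_zero [simp] = bilinear_operations[THEN bilinear_map_zero(1)]
  bilinear_operations[THEN bilinear_map_zero(2)]
lemmas operation_minus = bilinear_operations[THEN bilinear_map_minus(1)]
  bilinear_operations[THEN bilinear_map_minus(2)]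

lemma alpha_add: "\<alpha>\<^sub>A (a + b) = \<alpha>\<^sub>A a + \<alpha>\<^sub>A b" "\<alpha>\<^sub>H (x + y) = \<alpha>\<^sub>H x + \<alpha>\<^sub>H y"
  using linear_alphaA linear_alphaH by (simp_all add: Vector_Spaces.linear_iff)

lemma alpha_zero [simp]: "\<alpha>\<^sub>A 0 = 0" "\<alpha>\<^sub>H 0 = 0"
  using alpha_add(1)[of 0 0] alpha_add(2)[of 0 0] by simp_all

text \<open>Introduction rules that follow the syntax of an expression, so that linearity in a
  chosen variable is proved by backward chaining alone.\<close>

lemmas linear_maps = linear_to_tensor_linear[OF linear_cobracketA] linear_to_tensor_linear[OF linear_cobracketH]
  linear_to_tensor_linear[OF linear_phi] linear_to_tensor_linear[OF linear_psi]
  linear_to_tensor_linear[OF linear_P] linear_to_tensor_linear[OF linear_Q]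
  linear_identity[OF vector_space_A] linear_identity[OF vector_space_H] linear_identity[OF vector_space_E]
  linear_zero_map[OF _ vector_space_A] linear_zero_map[OF _ vector_space_H]
  linear_zero_map[OF _ vector_space_field]
  linear_comp[OF _ linear_alphaA] linear_comp[OF _ linear_alphaH]
  linear_comp[OF _ linear_fst] linear_comp[OF _ linear_snd] linear_Pair
  bilinear_operations[THEN bilinear_linear_left] bilinear_operations[THEN bilinear_linear_right]
  linear_add_maps linear_diff_maps linear_minus_map
  vector_space_A vector_space_H vector_space_E

lemma hom_vector_space_E: "hom_vector_space scaleE alphaE"
proof -
  have "Vector_Spaces.linear scaleE scaleE (\<lambda>u. (\<alpha>\<^sub>A (fst u), \<alpha>\<^sub>H (snd u)))"
    by (intro linear_maps)
  then show ?thesis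
    by (simp add: hom_vector_space_def vector_space_E alphaE_apply[abs_def])
qed

lemma bilinear_bracketE: "bilinear_map scaleE scaleE scaleE bracketE"
  unfolding bracketE_apply[abs_def] by (intro bilinear_mapI linear_maps)

lemma bracketE_add:
  "bracketE (u + u') v = bracketE u v + bracketE u' v" "bracketE u (v + v') = bracketE u v + bracketE u v'"
  using bilinear_map_add[OF bilinear_bracketE] by blast+

lemma alphaE_add: "alphaE (u + v) = alphaE u + alphaE v"
  by (simp add: alphaE_apply alpha_add)

section \<open>The Jacobi identity on the direct sum\<close>

definition jacobiator where
  "jacobiator u v w =
    bracketE (alphaE u) (bracketE v w) + bracketE (alphaE v) (bracketE w u) + bracketE (alphaE w) (bracketE u v)"

lemma jacobiator_add:
  "jacobiator (u + u') v w = jacobiator u v w + jacobiator u' v w"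
  by (simp add: jacobiator_def bracketE_add alphaE_add ac_simps)

lemma jacobiator_rotate: "jacobiator u v w = jacobiator v w u"
  by (simp add: jacobiator_def ac_simps)

lemma jacobiator_vanishes:
  assumes AAA: "\<And>a b c. jacobiator (a, 0) (b, 0) (c, 0) = 0"
    and HAA: "\<And>x a b. jacobiator (0, x) (a, 0) (b, 0) = 0"
    and HHA: "\<And>x y a. jacobiator (0, x) (0, y) (a, 0) = 0"
    and HHH: "\<And>x y z. jacobiator (0, x) (0, y) (0, z) = 0"
  shows "jacobiator u v w = 0"
proof -
  have split1: "jacobiator u v w = 0"
    if "jacobiator (fst u, 0) v w = 0" "jacobiator (0, snd u) v w = 0" for u v w
    using jacobiator_add[of "(fst u, 0)" "(0, snd u)" v w] that by simp
  \<comment> \<open>Additivity is available in the first argument only; a rotation brings the second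
    argument, and then the third, to the front.\<close>
  have split2: "jacobiator u v w = 0"
    if "jacobiator u (fst v, 0) w = 0" "jacobiator u (0, snd v) w = 0" for u v w
    using split1[of v w u] that by (simp add: jacobiator_rotate[of u])
  have split3: "jacobiator u v w = 0"
    if "jacobiator u v (fst w, 0) = 0" "jacobiator u v (0, snd w) = 0" for u v w
    using split2[of v w u] that by (simp add: jacobiator_rotate[of u])
  have AHA: "jacobiator (a, 0) (0, x) (b, 0) = 0" for a b x by (subst jacobiator_rotate) (rule HAA)
  have AHH: "jacobiator (a, 0) (0, x) (0, y) = 0" for a x y by (subst jacobiator_rotate) (rule HHA)
  have AAH: "jacobiator (a, 0) (b, 0) (0, x) = 0" for a b x by (subst jacobiator_rotate) (rule AHA)
  have HAH: "jacobiator (0, x) (a, 0) (0, y) = 0" for a x y by (subst jacobiator_rotate) (rule AHH)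
  show ?thesis
    by (rule split1; rule split2; rule split3) (rule AAA AAH AHA AHH HAA HAH HHA HHH)+
qed

lemma antisymmetric_bracketE:
  assumes "antisymmetric \<sigma>" "antisymmetric \<theta>"
  shows "antisymmetric bracketE"
proof -
  have swap: "\<lbrakk>b, a\<rbrakk>\<^sub>A = - \<lbrakk>a, b\<rbrakk>\<^sub>A" "\<lbrakk>y, x\<rbrakk>\<^sub>H = - \<lbrakk>x, y\<rbrakk>\<^sub>H" "\<sigma> y x = - \<sigma> x y" "\<theta> b a = - \<theta> a b" for b a y x
    using assms antisymmetric_bracketA antisymmetric_bracketH unfolding antisymmetric_def by blast+
  have "bracketE u v = - bracketE v u" for u v
    by (simp add: bracketE_apply prod_eq_iff swap(1)[of "fst v" "fst u"] swap(2)[of "snd v" "snd u"]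
        swap(3)[of "snd v" "snd u"] swap(4)[of "fst v" "fst u"])
  then show ?thesis unfolding antisymmetric_def by blast
qed

text \<open>Up to sign, each component of a Jacobi sum is the difference of the two sides of one
  axiom. Types AAA and HHH give the two cyclic identities of \<open>theta_hom_lie_algebra\<close>
  and \<open>sigma_hom_lie_algebra\<close>. For HAA the \<open>A\<close> component is
  \<open>TBB1\<close> and the \<open>H\<close> component \<open>TM2\<close>; for HHA they are
  \<open>TM1\<close> and \<open>TBB2\<close>.\<close>

lemma hom_lie_algebra_E:
  assumes "cocycle_cross_product_system"
  shows "hom_lie_algebra scaleE alphaE bracketE"
proof -
  have anti: "antisymmetric \<sigma>" "antisymmetric \<theta>"
    and A: "theta_hom_lie_algebra" and H: "sigma_hom_lie_algebra"
    and ax: "TM1" "TM2" "TBB1" "TBB2"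
    using assms
    by (auto simp: cocycle_cross_product_system_def theta_hom_lie_algebra_def sigma_hom_lie_algebra_def)
  have swapA: "\<lbrakk>b, a\<rbrakk>\<^sub>A = - \<lbrakk>a, b\<rbrakk>\<^sub>A" and swapH: "\<lbrakk>y, x\<rbrakk>\<^sub>H = - \<lbrakk>x, y\<rbrakk>\<^sub>H"
    and swap\<sigma>: "\<sigma> y x = - \<sigma> x y" and swap\<theta>: "\<theta> b a = - \<theta> a b" for b a y x
    using anti antisymmetric_bracketA antisymmetric_bracketH unfolding antisymmetric_def by blast+
  note J = jacobiator_def bracketE_apply alphaE_apply prod_eq_iff operation_minus
  have "jacobiator (a, 0) (b, 0) (c, 0) = 0" for a b c
  proof -
    \<comment> \<open>In the form \<open>= 0\<close> an axiom has the shape of a component of the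
      Jacobi sum. Antisymmetry is then applied only to brackets whose first argument is an image of
      \<open>\<alpha>\<^sub>A\<close>, which moves it to the second place as in the axiom.\<close>
    have "\<theta> a b \<triangleleft> \<alpha>\<^sub>A c + \<theta> b c \<triangleleft> \<alpha>\<^sub>A a + \<theta> c a \<triangleleft> \<alpha>\<^sub>A b
        - (\<theta> (\<alpha>\<^sub>A a) \<lbrakk>b, c\<rbrakk>\<^sub>A + \<theta> (\<alpha>\<^sub>A b) \<lbrakk>c, a\<rbrakk>\<^sub>A + \<theta> (\<alpha>\<^sub>A c) \<lbrakk>a, b\<rbrakk>\<^sub>A) = 0"
      "\<lbrakk>\<lbrakk>a, b\<rbrakk>\<^sub>A, \<alpha>\<^sub>A c\<rbrakk>\<^sub>A + \<lbrakk>\<lbrakk>b, c\<rbrakk>\<^sub>A, \<alpha>\<^sub>A a\<rbrakk>\<^sub>A + \<lbrakk>\<lbrakk>c, a\<rbrakk>\<^sub>A, \<alpha>\<^sub>A b\<rbrakk>\<^sub>A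
        + (\<theta> a b \<triangleright> \<alpha>\<^sub>A c + \<theta> b c \<triangleright> \<alpha>\<^sub>A a + \<theta> c a \<triangleright> \<alpha>\<^sub>A b) = 0"
      using A by (simp_all add: theta_hom_lie_algebra_def)
    then show ?thesis
      by (simp add: J swapA[of "\<alpha>\<^sub>A _"] algebra_simps neg_eq_iff_add_eq_0)
  qed
  moreover have "jacobiator (0, x) (a, 0) (b, 0) = 0" for x a b
  proof -
    have "\<alpha>\<^sub>H x \<triangleright> \<lbrakk>a, b\<rbrakk>\<^sub>A + \<sigma> (\<alpha>\<^sub>H x) (\<theta> a b) - (\<lbrakk>x \<triangleright> a, \<alpha>\<^sub>A b\<rbrakk>\<^sub>A + \<lbrakk>\<alpha>\<^sub>A a, x \<triangleright> b\<rbrakk>\<^sub>A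
        + (x \<triangleleft> a) \<triangleright> \<alpha>\<^sub>A b - (x \<triangleleft> b) \<triangleright> \<alpha>\<^sub>A a) = 0"
      "\<alpha>\<^sub>H x \<triangleleft> \<lbrakk>a, b\<rbrakk>\<^sub>A + \<lbrakk>\<alpha>\<^sub>H x, \<theta> a b\<rbrakk>\<^sub>H - ((x \<triangleleft> a) \<triangleleft> \<alpha>\<^sub>A b - (x \<triangleleft> b) \<triangleleft> \<alpha>\<^sub>A a
        + \<theta> (x \<triangleright> a) (\<alpha>\<^sub>A b) + \<theta> (\<alpha>\<^sub>A a) (x \<triangleright> b)) = 0"
      using ax by (simp_all add: TM2_def TBB1_def)
    then show ?thesis
      by (simp add: J swapA[of "\<alpha>\<^sub>A b"] swap\<theta>[of "\<alpha>\<^sub>A b"] algebra_simps)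
  qed
  moreover have "jacobiator (0, x) (0, y) (a, 0) = 0" for x y a
  proof -
    have "\<lbrakk>x, y\<rbrakk>\<^sub>H \<triangleright> \<alpha>\<^sub>A a + \<lbrakk>\<sigma> x y, \<alpha>\<^sub>A a\<rbrakk>\<^sub>A - (\<alpha>\<^sub>H x \<triangleright> (y \<triangleright> a) - \<alpha>\<^sub>H y \<triangleright> (x \<triangleright> a)
        + \<sigma> (\<alpha>\<^sub>H x) (y \<triangleleft> a) + \<sigma> (x \<triangleleft> a) (\<alpha>\<^sub>H y)) = 0"
      "\<lbrakk>x, y\<rbrakk>\<^sub>H \<triangleleft> \<alpha>\<^sub>A a + \<theta> (\<sigma> x y) (\<alpha>\<^sub>A a) - (\<lbrakk>\<alpha>\<^sub>H x, y \<triangleleft> a\<rbrakk>\<^sub>H + \<lbrakk>x \<triangleleft> a, \<alpha>\<^sub>H y\<rbrakk>\<^sub>H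
        + \<alpha>\<^sub>H x \<triangleleft> (y \<triangleright> a) - \<alpha>\<^sub>H y \<triangleleft> (x \<triangleright> a)) = 0"
      using ax by (simp_all add: TM1_def TBB2_def)
    then show ?thesis
      by (simp add: J swapA[of "\<alpha>\<^sub>A a"] swap\<theta>[of "\<alpha>\<^sub>A a"] swapH[of "\<alpha>\<^sub>H y"] swap\<sigma>[of "\<alpha>\<^sub>H y"] algebra_simps)
  qed
  moreover have "jacobiator (0, x) (0, y) (0, z) = 0" for x y z
  proof -
    have "\<alpha>\<^sub>H x \<triangleright> \<sigma> y z + \<alpha>\<^sub>H y \<triangleright> \<sigma> z x + \<alpha>\<^sub>H z \<triangleright> \<sigma> x y
        - (\<sigma> \<lbrakk>x, y\<rbrakk>\<^sub>H (\<alpha>\<^sub>H z) + \<sigma> \<lbrakk>y, z\<rbrakk>\<^sub>H (\<alpha>\<^sub>H x) + \<sigma> \<lbrakk>z, x\<rbrakk>\<^sub>H (\<alpha>\<^sub>H y)) = 0"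
      "\<lbrakk>\<lbrakk>x, y\<rbrakk>\<^sub>H, \<alpha>\<^sub>H z\<rbrakk>\<^sub>H + \<lbrakk>\<lbrakk>y, z\<rbrakk>\<^sub>H, \<alpha>\<^sub>H x\<rbrakk>\<^sub>H + \<lbrakk>\<lbrakk>z, x\<rbrakk>\<^sub>H, \<alpha>\<^sub>H y\<rbrakk>\<^sub>H
        - (\<alpha>\<^sub>H x \<triangleleft> \<sigma> y z + \<alpha>\<^sub>H y \<triangleleft> \<sigma> z x + \<alpha>\<^sub>H z \<triangleleft> \<sigma> x y) = 0"
      using H by (simp_all add: sigma_hom_lie_algebra_def)
    then show ?thesis
      by (simp add: J swapH[of "\<alpha>\<^sub>H _"] swap\<sigma>[of "\<alpha>\<^sub>H _"] algebra_simps)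
  qed
  ultimately show ?thesis
    using jacobiator_vanishes
    by (simp add: hom_lie_algebra_def hom_vector_space_E bilinear_bracketE
        antisymmetric_bracketE[OF anti] jacobiator_def)
qed

section \<open>The cobracket on the direct sum\<close>

lemmas functionals [simp] = linear_to_tensor_functional[OF linear_cobracketA]
  linear_to_tensor_functional[OF linear_cobracketH] linear_to_tensor_functional[OF linear_phi]
  linear_to_tensor_functional[OF linear_psi] linear_to_tensor_functional[OF linear_P]
  linear_to_tensor_functional[OF linear_Q]

lemmas functionals_null [simp] = functionals[THEN tensor_functional_null]
lemmas functionals_minus = functionals[THEN tensor_functional_minus]

lemmas cooperations_zero [simp] = linear_to_tensor_zero[OF linear_cobracketA]
  linear_to_tensor_zero[OF linear_cobracketH] linear_to_tensor_zero[OF linear_phi]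
  linear_to_tensor_zero[OF linear_psi] linear_to_tensor_zero[OF linear_P] linear_to_tensor_zero[OF linear_Q]

text \<open>The value of the cobracket on a bilinear form, without the guard that sends other functions to \<open>0\<close>.\<close>

definition cobracketE_form where
  "cobracketE_form u F =
    \<delta>\<^sub>A (fst u) (\<lambda>a b. F (a, 0) (b, 0)) + \<phi> (fst u) (\<lambda>x b. F (0, x) (b, 0))
    - \<phi> (fst u) (\<lambda>x b. F (b, 0) (0, x)) + P (fst u) (\<lambda>x y. F (0, x) (0, y))
    + (\<delta>\<^sub>H (snd u) (\<lambda>x y. F (0, x) (0, y)) + \<psi> (snd u) (\<lambda>x b. F (0, x) (b, 0))
    - \<psi> (snd u) (\<lambda>x b. F (b, 0) (0, x)) + Q (snd u) (\<lambda>a b. F (a, 0) (b, 0)))"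

lemma cobracketE_apply:
  assumes "bilinear_form scaleE scaleE F"
  shows "cobracketE u F = cobracketE_form u F"
  by (simp add: cobracketE_def case_prod_beta inclAA_def inclHA_def inclAH_def inclHH_def
      sweedler_apply tens_apply[OF assms] tau_apply cobracketE_form_def)

lemma inclusions_tensor_space:
  "t1 \<in> tensor_space sA sA \<Longrightarrow> inclAA t1 \<in> tensor_space scaleE scaleE"
  "t2 \<in> tensor_space sH sA \<Longrightarrow> inclHA t2 \<in> tensor_space scaleE scaleE"
  "t2 \<in> tensor_space sH sA \<Longrightarrow> inclAH (tau t2) \<in> tensor_space scaleE scaleE"
  "t3 \<in> tensor_space sH sH \<Longrightarrow> inclHH t3 \<in> tensor_space scaleE scaleE"
proof -
  note tens = bilinear_tens[OF vector_space_E vector_space_E]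
  note intros = bilinear_mapI bilinear_linear_left[OF tens] bilinear_linear_right[OF tens] linear_maps
    tens_in_tensor_space
  show "t1 \<in> tensor_space sA sA \<Longrightarrow> inclAA t1 \<in> tensor_space scaleE scaleE"
    unfolding inclAA_def by (rule sweedler_tensor_space, assumption) (intro intros)+
  show "t2 \<in> tensor_space sH sA \<Longrightarrow> inclHA t2 \<in> tensor_space scaleE scaleE"
    unfolding inclHA_def by (rule sweedler_tensor_space, assumption) (intro intros)+
  \<comment> \<open>Absorbing the flip into the inserted map leaves a Sigma expression in
    \<open>t2\<close> itself, so the membership lemma applies to it directly.\<close>
  have "inclAH (tau t2) = t2 \<star> (\<lambda>x b. tens scaleE scaleE (b, 0) (0, x))"
    by (simp add: inclAH_def sweedler_def tau_def)
  then show "t2 \<in> tensor_space sH sA \<Longrightarrow> inclAH (tau t2) \<in> tensor_space scaleE scaleE"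
    by simp (rule sweedler_tensor_space, assumption, (intro intros)+)
  show "t3 \<in> tensor_space sH sH \<Longrightarrow> inclHH t3 \<in> tensor_space scaleE scaleE"
    unfolding inclHH_def by (rule sweedler_tensor_space, assumption) (intro intros)+
qed

lemma linear_cobracketE: "linear_to_tensor scaleE scaleE scaleE cobracketE"
proof -
  have "Vector_Spaces.linear scaleE fun_scale cobracketE"
  proof (rule linear_fun_scaleI[OF vector_space_E])
    \<comment> \<open>In this locale the field has type \<open>'a\<close>, and the spaces
      \<open>A\<close> and \<open>H\<close> have types \<open>'b\<close> and
      \<open>'c\<close>.\<close>
    fix B :: "'b \<times> 'c \<Rightarrow> 'b \<times> 'c \<Rightarrow> 'a"
    show "Vector_Spaces.linear scaleE (*) (\<lambda>u. cobracketE u B)"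
      unfolding cobracketE_def case_prod_beta inclAA_def inclHA_def inclAH_def inclHH_def
        plus_fun_apply minus_apply sweedler_apply tau_apply
      by (intro linear_maps)
  qed
  moreover have "cobracketE u \<in> tensor_space scaleE scaleE" for u
    unfolding cobracketE_def case_prod_beta
    by (intro tensor_space_add tensor_space_diff inclusions_tensor_space
        linear_to_tensor_mem[OF linear_cobracketA] linear_to_tensor_mem[OF linear_cobracketH]
        linear_to_tensor_mem[OF linear_phi] linear_to_tensor_mem[OF linear_psi]
        linear_to_tensor_mem[OF linear_P] linear_to_tensor_mem[OF linear_Q])
  ultimately show ?thesis by (auto simp: linear_to_tensor_def)
qed

lemma functional_cobracketE: "tensor_functional scaleE scaleE (cobracketE u)"
  by (rule linear_to_tensor_functional[OF linear_cobracketE])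

text \<open>The mixed parts \<open>\<phi> - \<tau>\<phi>\<close> and
  \<open>\<psi> - \<tau>\<psi>\<close> are antisymmetric by construction; the pure parts are so by
  the antisymmetry of \<open>\<delta>\<^sub>A\<close>, \<open>\<delta>\<^sub>H\<close>,
  \<open>P\<close> and \<open>Q\<close>.\<close>

lemma co_antisymmetric_cobracketE:
  assumes "co_antisymmetric P" "co_antisymmetric Q"
  shows "co_antisymmetric cobracketE"
proof -
  have "cobracketE u F = (- tau (cobracketE u)) F" for u F
  proof (cases "bilinear_form scaleE scaleE F")
    case True
    note anti = co_antisymmetric_cobracketA[THEN co_antisymmetric_apply]
      co_antisymmetric_cobracketH[THEN co_antisymmetric_apply] assms[THEN co_antisymmetric_apply]
    show ?thesis
      \<comment> \<open>Each swap is fixed at one form, since as a general rewrite rule it would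
        undo itself forever.\<close>
      by (simp add: tau_apply cobracketE_apply[OF True] cobracketE_apply[OF bilinear_form_swap[OF True]]
          cobracketE_form_def anti(1)[of _ "\<lambda>a b. F (b, 0) (a, 0)"] anti(2)[of _ "\<lambda>x y. F (0, y) (0, x)"]
          anti(3)[of _ "\<lambda>x y. F (0, y) (0, x)"] anti(4)[of _ "\<lambda>a b. F (b, 0) (a, 0)"])
  next
    case False
    then have "\<not> bilinear_form scaleE scaleE (\<lambda>u v. F v u)"
      using bilinear_form_swap[of scaleE scaleE "(*)" "\<lambda>u v. F v u"] by auto
    with False show ?thesis
      by (simp add: tau_apply tensor_functional_outside[OF functional_cobracketE])
  qed
  then show ?thesis unfolding co_antisymmetric_def by blast
qed

section \<open>The co-Jacobi identity on the direct sum\<close>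

lemma iterated_cobracketE:
  assumes B: "trilinear_form scaleE scaleE scaleE B"
  shows "iterated_cobracket alphaE cobracketE u B =
    cobracketE_form u (\<lambda>x1 x2. cobracketE_form x2 (\<lambda>v w. B (alphaE x1) v w))"
proof -
  have "bilinear_form scaleE scaleE (\<lambda>x1 x2. cobracketE x2 (\<lambda>v w. B (alphaE x1) v w))"
    by (rule bilinear_form_iterated[OF hom_vector_space_E linear_cobracketE B])
  then show ?thesis
    by (simp add: iterated_cobracket_def cobracketE_apply cobracketE_apply[OF trilinear_bilinear1[OF B]])
qed

lemma co_jacobiatorE:
  assumes B: "trilinear_form scaleE scaleE scaleE B"
  shows "co_jacobiator alphaE cobracketE u B =
    cobracketE_form u (\<lambda>x1 x2. cobracketE_form x2 (\<lambda>v w. B (alphaE x1) v w))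
    + cobracketE_form u (\<lambda>x1 x2. cobracketE_form x2 (\<lambda>v w. B w (alphaE x1) v))
    + cobracketE_form u (\<lambda>x1 x2. cobracketE_form x2 (\<lambda>v w. B v w (alphaE x1)))"
  unfolding co_jacobiator_def
  by (simp add: iterated_cobracketE[OF B] iterated_cobracketE[OF trilinear_form_rotate(1)[OF B]]
      iterated_cobracketE[OF trilinear_form_rotate(2)[OF B]])

lemma co_jacobiator_vanishes:
  assumes AAA: "\<And>u \<beta>. trilinear_form sA sA sA \<beta>
      \<Longrightarrow> co_jacobiator alphaE cobracketE u (\<lambda>u v w. \<beta> (fst u) (fst v) (fst w)) = 0"
    and HAA: "\<And>u \<beta>. trilinear_form sH sA sA \<beta>
      \<Longrightarrow> co_jacobiator alphaE cobracketE u (\<lambda>u v w. \<beta> (snd u) (fst v) (fst w)) = 0"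
    and HHA: "\<And>u \<beta>. trilinear_form sH sH sA \<beta>
      \<Longrightarrow> co_jacobiator alphaE cobracketE u (\<lambda>u v w. \<beta> (snd u) (snd v) (fst w)) = 0"
    and HHH: "\<And>u \<beta>. trilinear_form sH sH sH \<beta>
      \<Longrightarrow> co_jacobiator alphaE cobracketE u (\<lambda>u v w. \<beta> (snd u) (snd v) (snd w)) = 0"
    and B: "trilinear_form scaleE scaleE scaleE B"
  shows "co_jacobiator alphaE cobracketE u B = 0"
proof -
  let ?J = "co_jacobiator alphaE cobracketE u"
  let ?A = "\<lambda>u :: 'b \<times> 'c. (fst u, 0) :: 'b \<times> 'c" and ?H = "\<lambda>u :: 'b \<times> 'c. (0, snd u) :: 'b \<times> 'c"
  have tri: "trilinear_form r1 r2 r3 (\<lambda>u v w. T (f u) (g v) (h w))"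
    if "trilinear_form scaleE scaleE scaleE T"
      "Vector_Spaces.linear r1 scaleE f" "Vector_Spaces.linear r2 scaleE g" "Vector_Spaces.linear r3 scaleE h"
    for T f g h and r1 :: "'a \<Rightarrow> 'x::ab_group_add \<Rightarrow> 'x" and r2 :: "'a \<Rightarrow> 'y::ab_group_add \<Rightarrow> 'y"
      and r3 :: "'a \<Rightarrow> 'z::ab_group_add \<Rightarrow> 'z"
    by (intro trilinear_mapI trilinear_linear1[OF that(1)] trilinear_linear2[OF that(1)]
        trilinear_linear3[OF that(1)] that(2,3,4))
  \<comment> \<open>Composing a form with the projections \<open>?A\<close> and \<open>?H\<close>
    amounts to pulling back its restriction to the summands, which is the shape of the
    assumptions.\<close>
  have AAA': "?J (\<lambda>u v w. T (?A u) (?A v) (?A w)) = 0"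
    and HAA': "?J (\<lambda>u v w. T (?H u) (?A v) (?A w)) = 0"
    and HHA': "?J (\<lambda>u v w. T (?H u) (?H v) (?A w)) = 0"
    and HHH': "?J (\<lambda>u v w. T (?H u) (?H v) (?H w)) = 0"
    if T: "trilinear_form scaleE scaleE scaleE T" for T
    using AAA[of "\<lambda>a b c. T (a, 0) (b, 0) (c, 0)" u] HAA[of "\<lambda>x b c. T (0, x) (b, 0) (c, 0)" u]
      HHA[of "\<lambda>x y c. T (0, x) (0, y) (c, 0)" u] HHH[of "\<lambda>x y z. T (0, x) (0, y) (0, z)" u]
    by (simp_all add: tri[OF T] linear_maps)
  have decomposition: "B = (\<lambda>u v w. B (?A u) (?A v) (?A w) + B (?H u) (?H v) (?H w)
      + B (?H u) (?A v) (?A w) + B (?A u) (?H v) (?A w) + B (?A u) (?A v) (?H w)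
      + B (?H u) (?H v) (?A w) + B (?H u) (?A v) (?H w) + B (?A u) (?H v) (?H w))"
  proof (intro ext)
    fix u v w
    have "B u v w = B (?A u + ?H u) (?A v + ?H v) (?A w + ?H w)" by simp
    then show "B u v w = B (?A u) (?A v) (?A w) + B (?H u) (?H v) (?H w)
      + B (?H u) (?A v) (?A w) + B (?A u) (?H v) (?A w) + B (?A u) (?A v) (?H w)
      + B (?H u) (?H v) (?A w) + B (?H u) (?A v) (?H w) + B (?A u) (?H v) (?H w)"
      by (simp only: trilinear_map_add[OF B] ac_simps)
  qed
  have trs: "trilinear_form scaleE scaleE scaleE (\<lambda>u v w. B (?A u) (?A v) (?A w))"
    "trilinear_form scaleE scaleE scaleE (\<lambda>u v w. B (?H u) (?H v) (?H w))"
    "trilinear_form scaleE scaleE scaleE (\<lambda>u v w. B (?H u) (?A v) (?A w))"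
    "trilinear_form scaleE scaleE scaleE (\<lambda>u v w. B (?A u) (?H v) (?A w))"
    "trilinear_form scaleE scaleE scaleE (\<lambda>u v w. B (?A u) (?A v) (?H w))"
    "trilinear_form scaleE scaleE scaleE (\<lambda>u v w. B (?H u) (?H v) (?A w))"
    "trilinear_form scaleE scaleE scaleE (\<lambda>u v w. B (?H u) (?A v) (?H w))"
    "trilinear_form scaleE scaleE scaleE (\<lambda>u v w. B (?A u) (?H v) (?H w))"
    by (intro tri[OF B] linear_maps)+
  have add: "?J (\<lambda>u v w. S u v w + T u v w) = ?J S + ?J T"
    if "trilinear_form scaleE scaleE scaleE S" "trilinear_form scaleE scaleE scaleE T" for S T
    using that by (rule co_jacobiator_add[OF hom_vector_space_E linear_cobracketE])
  \<comment> \<open>The remaining four mixed types are cyclic rotations of HAA and HHA; those two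
    cases are applied to rotated copies of \<open>B\<close> and rotated back.\<close>
  have rotations: "?J (\<lambda>u v w. B (?A u) (?A v) (?H w)) = 0" "?J (\<lambda>u v w. B (?A u) (?H v) (?A w)) = 0"
    "?J (\<lambda>u v w. B (?A u) (?H v) (?H w)) = 0" "?J (\<lambda>u v w. B (?H u) (?A v) (?H w)) = 0"
    using HAA'[OF trilinear_form_rotate(2)[OF B]] HAA'[OF trilinear_form_rotate(1)[OF B]]
      HHA'[OF trilinear_form_rotate(1)[OF B]] HHA'[OF trilinear_form_rotate(2)[OF B]]
      co_jacobiator_rotate(1)[of alphaE cobracketE u "\<lambda>u v w. B (?A v) (?A w) (?H u)"]
      co_jacobiator_rotate(2)[of alphaE cobracketE u "\<lambda>u v w. B (?A w) (?H u) (?A v)"]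
      co_jacobiator_rotate(2)[of alphaE cobracketE u "\<lambda>u v w. B (?A w) (?H u) (?H v)"]
      co_jacobiator_rotate(1)[of alphaE cobracketE u "\<lambda>u v w. B (?H v) (?A w) (?H u)"]
    by simp_all
  show ?thesis
    by (subst decomposition)
      (simp only: add trilinear_form_add trs AAA'[OF B] HHH'[OF B] HAA'[OF B] HHA'[OF B] rotations add_0)
qed

text \<open>The contributions of \<open>fst u\<close> and \<open>snd u\<close> to the cyclic sum
  vanish separately, each by one axiom. Forms of type AAA and HHH lead to the cyclic identities of
  the \<open>Q\<close>- and \<open>P\<close>-Hom-Lie coalgebras; HAA leads to \<open>TBB3\<close>
  for \<open>fst u\<close> and \<open>TM4\<close> for \<open>snd u\<close>; HHA leads to
  \<open>TM3\<close> and \<open>TBB4\<close>.\<close>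

lemma hom_lie_coalgebra_E:
  assumes "cycle_cross_coproduct_system"
  shows "hom_lie_coalgebra scaleE alphaE cobracketE"
proof -
  have anti: "co_antisymmetric P" "co_antisymmetric Q"
    and Q: "Q_hom_lie_coalgebra" and P: "P_hom_lie_coalgebra"
    and ax: "TM3" "TM4" "TBB3" "TBB4"
    using assms
    by (auto simp: cycle_cross_coproduct_system_def Q_hom_lie_coalgebra_def P_hom_lie_coalgebra_def)
  note swap = co_antisymmetric_cobracketA[THEN co_antisymmetric_apply]
    co_antisymmetric_cobracketH[THEN co_antisymmetric_apply] anti[THEN co_antisymmetric_apply]
  \<comment> \<open>In the iterated cobracket the inner co-operation acts on the second factor,
    while some axioms apply it to the first. These instances of the swap move it to the second
    factor and no longer match afterwards, so rewriting with them terminates.\<close>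
  have flip: "\<And>a T. \<delta>\<^sub>A a (\<lambda>u v. \<delta>\<^sub>A u (T v)) = - \<delta>\<^sub>A a (\<lambda>u v. \<delta>\<^sub>A v (T u))"
    "\<And>x T. \<delta>\<^sub>H x (\<lambda>u v. \<delta>\<^sub>H u (T v)) = - \<delta>\<^sub>H x (\<lambda>u v. \<delta>\<^sub>H v (T u))"
    "\<And>a T. P a (\<lambda>u v. \<delta>\<^sub>H u (T v)) = - P a (\<lambda>u v. \<delta>\<^sub>H v (T u))"
    "\<And>a T. \<delta>\<^sub>A a (\<lambda>u v. \<phi> u (T v)) = - \<delta>\<^sub>A a (\<lambda>u v. \<phi> v (T u))"
    "\<And>x T. Q x (\<lambda>u v. \<phi> u (T v)) = - Q x (\<lambda>u v. \<phi> v (T u))"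
    "\<And>x T. \<delta>\<^sub>H x (\<lambda>u v. \<psi> u (T v)) = - \<delta>\<^sub>H x (\<lambda>u v. \<psi> v (T u))"
    "\<And>a T. P a (\<lambda>u v. \<psi> u (T v)) = - P a (\<lambda>u v. \<psi> v (T u))"
    "\<And>a T. \<delta>\<^sub>A a (\<lambda>u v. P u (T v)) = - \<delta>\<^sub>A a (\<lambda>u v. P v (T u))"
    "\<And>x T. Q x (\<lambda>u v. P u (T v)) = - Q x (\<lambda>u v. P v (T u))"
    by (rule swap)+
  have AAA: "co_jacobiator alphaE cobracketE u (\<lambda>u v w. \<beta> (fst u) (fst v) (fst w)) = 0"
    if \<beta>: "trilinear_form sA sA sA \<beta>" for u \<beta>
  proof -
    have tri: "trilinear_form scaleE scaleE scaleE (\<lambda>u v w. \<beta> (fst u) (fst v) (fst w))"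
      by (intro trilinear_mapI trilinear_linear1[OF \<beta>] trilinear_linear2[OF \<beta>]
        trilinear_linear3[OF \<beta>] linear_maps)
    note rot = trilinear_form_rotate[OF \<beta>]
    note ev = sweedler_apply tens_left_apply[OF \<beta>] tens_right_apply[OF \<beta>] Cyc_apply
      tens_left_apply[OF rot(1)] tens_right_apply[OF rot(1)] tens_left_apply[OF rot(2)] tens_right_apply[OF rot(2)]
    from Q have "Cyc (\<psi> x \<star> (\<lambda>x0 xp. Q x0 \<otimes>\<^bsub>AA|A\<^esub> \<alpha>\<^sub>A xp)) \<beta> - Cyc (Q x \<star> (\<lambda>q1 q2. \<alpha>\<^sub>A q1 \<otimes>\<^bsub>A|AA\<^esub> \<delta>\<^sub>A q2)) \<beta> = 0"
      "Cyc (\<delta>\<^sub>A a \<star> (\<lambda>a1 a2. \<delta>\<^sub>A a1 \<otimes>\<^bsub>AA|A\<^esub> \<alpha>\<^sub>A a2)) \<beta>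
      + Cyc (\<phi> a \<star> (\<lambda>am a0. Q am \<otimes>\<^bsub>AA|A\<^esub> \<alpha>\<^sub>A a0)) \<beta> = 0" for a x
      unfolding Q_hom_lie_coalgebra_def by simp_all
    from this(1)[of "snd u"] this(2)[of "fst u"] show ?thesis
      by (simp add: co_jacobiatorE[OF tri] cobracketE_form_def alphaE_apply trilinear_map_zero[OF \<beta>] functionals_minus ev flip) algebra
  qed
  have HAA: "co_jacobiator alphaE cobracketE u (\<lambda>u v w. \<beta> (snd u) (fst v) (fst w)) = 0"
    if \<beta>: "trilinear_form sH sA sA \<beta>" for u \<beta>
  proof -
    have tri: "trilinear_form scaleE scaleE scaleE (\<lambda>u v w. \<beta> (snd u) (fst v) (fst w))"
      by (intro trilinear_mapI trilinear_linear1[OF \<beta>] trilinear_linear2[OF \<beta>]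
        trilinear_linear3[OF \<beta>] linear_maps)
    note ev = sweedler_apply tens_left_apply[OF \<beta>] tens_right_apply[OF \<beta>] tau12_apply tau23_apply
      tens_left_apply[OF trilinear_form_swap12[OF \<beta>]] tens_right_apply[OF trilinear_form_swap23[OF \<beta>]]
    show ?thesis
      using fun_cong[OF ax(2)[unfolded TM4_def, rule_format, of "snd u"], of \<beta>]
        fun_cong[OF ax(3)[unfolded TBB3_def, rule_format, of "fst u"], of \<beta>]
      by (simp add: co_jacobiatorE[OF tri] cobracketE_form_def alphaE_apply trilinear_map_zero[OF \<beta>] functionals_minus ev flip) algebra
  qed
  have HHA: "co_jacobiator alphaE cobracketE u (\<lambda>u v w. \<beta> (snd u) (snd v) (fst w)) = 0"
    if \<beta>: "trilinear_form sH sH sA \<beta>" for u \<beta>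
  proof -
    have tri: "trilinear_form scaleE scaleE scaleE (\<lambda>u v w. \<beta> (snd u) (snd v) (fst w))"
      by (intro trilinear_mapI trilinear_linear1[OF \<beta>] trilinear_linear2[OF \<beta>]
        trilinear_linear3[OF \<beta>] linear_maps)
    note ev = sweedler_apply tens_left_apply[OF \<beta>] tens_right_apply[OF \<beta>] tau12_apply tau23_apply
      tens_left_apply[OF trilinear_form_swap12[OF \<beta>]] tens_right_apply[OF trilinear_form_swap23[OF \<beta>]]
    show ?thesis
      using fun_cong[OF ax(4)[unfolded TBB4_def, rule_format, of "snd u"], of \<beta>]
        fun_cong[OF ax(1)[unfolded TM3_def, rule_format, of "fst u"], of \<beta>]
      by (simp add: co_jacobiatorE[OF tri] cobracketE_form_def alphaE_apply trilinear_map_zero[OF \<beta>] functionals_minus ev flip) algebra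
  qed
  have HHH: "co_jacobiator alphaE cobracketE u (\<lambda>u v w. \<beta> (snd u) (snd v) (snd w)) = 0"
    if \<beta>: "trilinear_form sH sH sH \<beta>" for u \<beta>
  proof -
    have tri: "trilinear_form scaleE scaleE scaleE (\<lambda>u v w. \<beta> (snd u) (snd v) (snd w))"
      by (intro trilinear_mapI trilinear_linear1[OF \<beta>] trilinear_linear2[OF \<beta>]
        trilinear_linear3[OF \<beta>] linear_maps)
    note rot = trilinear_form_rotate[OF \<beta>]
    note ev = sweedler_apply tens_left_apply[OF \<beta>] tens_right_apply[OF \<beta>] Cyc_apply
      tens_left_apply[OF rot(1)] tens_right_apply[OF rot(1)] tens_left_apply[OF rot(2)] tens_right_apply[OF rot(2)]
    from P have "Cyc (\<phi> a \<star> (\<lambda>am a0. \<alpha>\<^sub>H am \<otimes>\<^bsub>H|HH\<^esub> P a0)) \<beta>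
        - Cyc (P a \<star> (\<lambda>p1 p2. \<delta>\<^sub>H p1 \<otimes>\<^bsub>HH|H\<^esub> \<alpha>\<^sub>H p2)) \<beta> = 0"
      "Cyc (\<delta>\<^sub>H x \<star> (\<lambda>x1 x2. \<delta>\<^sub>H x1 \<otimes>\<^bsub>HH|H\<^esub> \<alpha>\<^sub>H x2)) \<beta>
        - Cyc (\<psi> x \<star> (\<lambda>x0 xp. \<alpha>\<^sub>H x0 \<otimes>\<^bsub>H|HH\<^esub> P xp)) \<beta> = 0" for a x
      unfolding P_hom_lie_coalgebra_def by simp_all
    from this(1)[of "fst u"] this(2)[of "snd u"] show ?thesis
      by (simp add: co_jacobiatorE[OF tri] cobracketE_form_def alphaE_apply trilinear_map_zero[OF \<beta>] functionals_minus ev flip) algebra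
  qed
  have "co_jacobiator alphaE cobracketE u B = 0" if "trilinear_form scaleE scaleE scaleE B" for u B
    by (rule co_jacobiator_vanishes[OF AAA HAA HHA HHH that])
  then show ?thesis
    unfolding hom_lie_coalgebra_def
    using co_jacobi_iff[OF hom_vector_space_E linear_cobracketE co_antisymmetric_cobracketE[OF anti]]
      hom_vector_space_E linear_cobracketE co_antisymmetric_cobracketE[OF anti] by blast
qed

section \<open>Compatibility of bracket and cobracket\<close>

text \<open>The \<open>A \<otimes> H\<close> component of an antisymmetric tensor is determined by the \<open>H \<otimes> A\<close> component.\<close>

lemma tensorE_eq_iff:
  assumes S: "tensor_functional scaleE scaleE S" "\<And>B. bilinear_form scaleE scaleE B \<Longrightarrow> S (\<lambda>u v. B v u) = - S B"
    and T: "tensor_functional scaleE scaleE T" "\<And>B. bilinear_form scaleE scaleE B \<Longrightarrow> T (\<lambda>u v. B v u) = - T B"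
  shows "S = T \<longleftrightarrow>
    (\<forall>\<beta>. bilinear_form sA sA \<beta> \<longrightarrow> S (\<lambda>u v. \<beta> (fst u) (fst v)) = T (\<lambda>u v. \<beta> (fst u) (fst v))) \<and>
    (\<forall>\<beta>. bilinear_form sH sA \<beta> \<longrightarrow> S (\<lambda>u v. \<beta> (snd u) (fst v)) = T (\<lambda>u v. \<beta> (snd u) (fst v))) \<and>
    (\<forall>\<beta>. bilinear_form sH sH \<beta> \<longrightarrow> S (\<lambda>u v. \<beta> (snd u) (snd v)) = T (\<lambda>u v. \<beta> (snd u) (snd v)))"
    (is "_ \<longleftrightarrow> ?AA \<and> ?HA \<and> ?HH")
proof
  assume "?AA \<and> ?HA \<and> ?HH"
  then have AA: ?AA and HA: ?HA and HH: ?HH by blast+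
  show "S = T"
  proof (rule tensor_functional_eqI[OF S(1) T(1)])
    fix B :: "'b \<times> 'c \<Rightarrow> 'b \<times> 'c \<Rightarrow> 'a"
    assume B: "bilinear_form scaleE scaleE B"
    note intros = bilinear_mapI bilinear_linear_left[OF B] bilinear_linear_right[OF B] linear_maps
    have forms: "bilinear_form scaleE scaleE (\<lambda>u v. B (fst u, 0) (fst v, 0))"
      "bilinear_form scaleE scaleE (\<lambda>u v. B (0, snd u) (fst v, 0))"
      "bilinear_form scaleE scaleE (\<lambda>u v. B (fst u, 0) (0, snd v))"
      "bilinear_form scaleE scaleE (\<lambda>u v. B (fst v, 0) (0, snd u))"
      "bilinear_form scaleE scaleE (\<lambda>u v. B (0, snd u) (0, snd v))"
      by (intro intros)+
    have small: "bilinear_form sA sA (\<lambda>a b. B (a, 0) (b, 0))" "bilinear_form sH sA (\<lambda>x b. B (0, x) (b, 0))"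
      "bilinear_form sH sA (\<lambda>x b. B (b, 0) (0, x))" "bilinear_form sH sH (\<lambda>x y. B (0, x) (0, y))"
      by (intro intros)+
    have "B = (\<lambda>u v. B (fst u, 0) (fst v, 0) + B (0, snd u) (fst v, 0)
        + B (fst u, 0) (0, snd v) + B (0, snd u) (0, snd v))" (is "_ = ?D")
    proof (intro ext)
      fix u v
      have "B u v = B ((fst u, 0) + (0, snd u)) ((fst v, 0) + (0, snd v))" by simp
      then show "B u v = ?D u v" by (simp only: bilinear_map_add[OF B] ac_simps)
    qed
    \<comment> \<open>The \<open>A \<otimes> H\<close> summand is not a pullback from
      \<open>H\<close> times \<open>A\<close>, but its flip \<open>forms(4)\<close> is, namely of
      \<open>small(3)\<close>; antisymmetry of \<open>S\<close> and \<open>T\<close> passes between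
      the two.\<close>
    moreover have "S ?D = T ?D"
      using AA[rule_format, OF small(1)] HA[rule_format, OF small(2)] HA[rule_format, OF small(3)]
        HH[rule_format, OF small(4)] S(2)[OF forms(4)] T(2)[OF forms(4)]
      by (simp add: tensor_functional_sum[OF S(1)] tensor_functional_sum[OF T(1)] forms bilinear_form_add)
    ultimately show "S B = T B" by simp
  qed
qed simp

abbreviation compatE where "compatE \<equiv> compatible scaleE alphaE bracketE cobracketE"

definition compatibility_rhs where
  "compatibility_rhs u v = bracket_left scaleE alphaE bracketE (alphaE u) (cobracketE v)
    + bracket_right scaleE alphaE bracketE (cobracketE u) (alphaE v)"

lemma cobracketE_left:
  assumes "bilinear_form scaleE scaleE B"
  shows "bracket_left scaleE alphaE bracketE z (cobracketE u) B =
    cobracketE_form u (\<lambda>u v. B (bracketE z u) (alphaE v)) + cobracketE_form u (\<lambda>u v. B (alphaE u) (bracketE z v))"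
  by (simp add: bracket_left_form[OF hom_vector_space_E bilinear_bracketE functional_cobracketE assms]
      cobracketE_apply bilinear_form_bracket_left[OF hom_vector_space_E bilinear_bracketE assms])

lemma cobracketE_right:
  assumes "bilinear_form scaleE scaleE B"
  shows "bracket_right scaleE alphaE bracketE (cobracketE u) z B =
    cobracketE_form u (\<lambda>u v. B (bracketE u z) (alphaE v)) + cobracketE_form u (\<lambda>u v. B (alphaE u) (bracketE v z))"
  by (simp add: bracket_right_form[OF hom_vector_space_E bilinear_bracketE functional_cobracketE assms]
      cobracketE_apply bilinear_form_bracket_right[OF hom_vector_space_E bilinear_bracketE assms])

lemma compatibility_rhs_apply:
  assumes "bilinear_form scaleE scaleE B"
  shows "compatibility_rhs u v B =
    cobracketE_form v (\<lambda>v1 v2. B (bracketE (alphaE u) v1) (alphaE v2))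
    + cobracketE_form v (\<lambda>v1 v2. B (alphaE v1) (bracketE (alphaE u) v2))
    + (cobracketE_form u (\<lambda>u1 u2. B (bracketE u1 (alphaE v)) (alphaE u2))
    + cobracketE_form u (\<lambda>u1 u2. B (alphaE u1) (bracketE u2 (alphaE v))))"
  unfolding compatibility_rhs_def by (simp add: cobracketE_left[OF assms] cobracketE_right[OF assms])

section \<open>The nine equations as components of the compatibility condition\<close>

lemma pulled_back_forms:
  "bilinear_form sA sA \<beta>1 \<Longrightarrow> bilinear_form scaleE scaleE (\<lambda>u v. \<beta>1 (fst u) (fst v))"
  "bilinear_form sH sA \<beta>2 \<Longrightarrow> bilinear_form scaleE scaleE (\<lambda>u v. \<beta>2 (snd u) (fst v))"
  "bilinear_form sH sH \<beta>3 \<Longrightarrow> bilinear_form scaleE scaleE (\<lambda>u v. \<beta>3 (snd u) (snd v))"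
  by (intro bilinear_mapI linear_maps; erule bilinear_linear_left bilinear_linear_right; intro linear_maps)+

lemmas evaluate_components = cobracketE_form_def bracketE_apply alphaE_apply functionals_minus sweedler_apply
  bracket_left_form[OF hom_vector_space_A bilinear_bracketA] bracket_left_form[OF hom_vector_space_H bilinear_bracketH]
  bracket_right_form[OF hom_vector_space_A bilinear_bracketA] bracket_right_form[OF hom_vector_space_H bilinear_bracketH]

lemmas evaluate_outside = sweedler_apply tens_apply_outside bracket_left_def bracket_right_def
  functionals[THEN tensor_functional_outside]

text \<open>This and the next eight lemmas fill a square table. With components in the order AA, HA,
  HH, the arguments \<open>(a, 0), (b, 0)\<close> give \<open>TLB3\<close>, \<open>TBB7\<close>,
  \<open>TLB1\<close>; the arguments \<open>(0, x), (a, 0)\<close> give \<open>TBB5\<close>,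
  \<open>TYD\<close>, \<open>TBB6\<close>; the arguments \<open>(0, x), (0, y)\<close> give
  \<open>TLB2\<close>, \<open>TBB8\<close>, \<open>TLB4\<close>.\<close>

lemma TBB5_iff: "TBB5 \<longleftrightarrow> (\<forall>a x \<beta>. bilinear_form sA sA \<beta> \<longrightarrow>
    cobracketE (bracketE (0, x) (a, 0)) (\<lambda>u v. \<beta> (fst u) (fst v)) =
    compatibility_rhs (0, x) (a, 0) (\<lambda>u v. \<beta> (fst u) (fst v)))"
  unfolding TBB5_def fun_eq_iff
proof (intro iff_allI, goal_cases)
  case (1 a x \<beta>)
  show ?case
  proof (cases "bilinear_form sA sA \<beta>")
    case True
    note B = pulled_back_forms(1)[OF True]
    show ?thesis
      by (simp only: True simp_thms cobracketE_apply[OF B] compatibility_rhs_apply[OF B],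
          \<comment> \<open>Left sides and right sides agree separately, not merely their
            differences, so the equivalence splits into two plain expansions.\<close>
          rule arg_cong2[where f = "(=)"];
          simp add: evaluate_components bilinear_map_zero[OF True] bilinear_map_minus[OF True] tens_apply[OF True] True)
  qed (simp add: evaluate_outside)
qed

lemma TBB6_iff: "TBB6 \<longleftrightarrow> (\<forall>a x \<beta>. bilinear_form sH sH \<beta> \<longrightarrow>
    cobracketE (bracketE (0, x) (a, 0)) (\<lambda>u v. \<beta> (snd u) (snd v)) =
    compatibility_rhs (0, x) (a, 0) (\<lambda>u v. \<beta> (snd u) (snd v)))"
  unfolding TBB6_def fun_eq_iff
proof (intro iff_allI, goal_cases)
  case (1 a x \<beta>)
  show ?case
  proof (cases "bilinear_form sH sH \<beta>")
    case True
    note B = pulled_back_forms(3)[OF True]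
    show ?thesis
      by (simp only: True simp_thms cobracketE_apply[OF B] compatibility_rhs_apply[OF B],
          rule arg_cong2[where f = "(=)"];
          simp add: evaluate_components bilinear_map_zero[OF True] bilinear_map_minus[OF True] tens_apply[OF True] True)
  qed (simp add: evaluate_outside)
qed

lemma TBB7_iff: "TBB7 \<longleftrightarrow> (\<forall>a b \<beta>. bilinear_form sH sA \<beta> \<longrightarrow>
    cobracketE (bracketE (a, 0) (b, 0)) (\<lambda>u v. \<beta> (snd u) (fst v)) =
    compatibility_rhs (a, 0) (b, 0) (\<lambda>u v. \<beta> (snd u) (fst v)))"
  unfolding TBB7_def fun_eq_iff
proof (intro iff_allI, goal_cases)
  case (1 a b \<beta>)
  show ?case
  proof (cases "bilinear_form sH sA \<beta>")
    case True
    note B = pulled_back_forms(2)[OF True]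
    show ?thesis
      by (simp only: True simp_thms cobracketE_apply[OF B] compatibility_rhs_apply[OF B],
          rule arg_cong2[where f = "(=)"];
          simp add: evaluate_components bilinear_map_zero[OF True] bilinear_map_minus[OF True] tens_apply[OF True] True)
  qed (simp add: evaluate_outside)
qed

lemma TBB8_iff: "TBB8 \<longleftrightarrow> (\<forall>x y \<beta>. bilinear_form sH sA \<beta> \<longrightarrow>
    cobracketE (bracketE (0, x) (0, y)) (\<lambda>u v. \<beta> (snd u) (fst v)) =
    compatibility_rhs (0, x) (0, y) (\<lambda>u v. \<beta> (snd u) (fst v)))"
  unfolding TBB8_def fun_eq_iff
proof (intro iff_allI, goal_cases)
  case (1 x y \<beta>)
  show ?case
  proof (cases "bilinear_form sH sA \<beta>")
    case True
    note B = pulled_back_forms(2)[OF True]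
    show ?thesis
      by (simp only: True simp_thms cobracketE_apply[OF B] compatibility_rhs_apply[OF B],
          rule arg_cong2[where f = "(=)"];
          simp add: evaluate_components bilinear_map_zero[OF True] bilinear_map_minus[OF True] tens_apply[OF True] True)
  qed (simp add: evaluate_outside)
qed

lemma TLB1_iff: "TLB1 \<longleftrightarrow> (\<forall>a b \<beta>. bilinear_form sH sH \<beta> \<longrightarrow>
    cobracketE (bracketE (a, 0) (b, 0)) (\<lambda>u v. \<beta> (snd u) (snd v)) =
    compatibility_rhs (a, 0) (b, 0) (\<lambda>u v. \<beta> (snd u) (snd v)))"
  unfolding TLB1_def fun_eq_iff
proof (intro iff_allI, goal_cases)
  case (1 a b \<beta>)
  show ?case
  proof (cases "bilinear_form sH sH \<beta>")
    case True
    note B = pulled_back_forms(3)[OF True]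
    show ?thesis
      by (simp only: True simp_thms cobracketE_apply[OF B] compatibility_rhs_apply[OF B],
          rule arg_cong2[where f = "(=)"];
          simp add: evaluate_components bilinear_map_zero[OF True] bilinear_map_minus[OF True] tens_apply[OF True] True)
  qed (simp add: evaluate_outside)
qed

lemma TLB2_iff: "TLB2 \<longleftrightarrow> (\<forall>x y \<beta>. bilinear_form sA sA \<beta> \<longrightarrow>
    cobracketE (bracketE (0, x) (0, y)) (\<lambda>u v. \<beta> (fst u) (fst v)) =
    compatibility_rhs (0, x) (0, y) (\<lambda>u v. \<beta> (fst u) (fst v)))"
  unfolding TLB2_def fun_eq_iff
proof (intro iff_allI, goal_cases)
  case (1 x y \<beta>)
  show ?case
  proof (cases "bilinear_form sA sA \<beta>")
    case True
    note B = pulled_back_forms(1)[OF True]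
    show ?thesis
      by (simp only: True simp_thms cobracketE_apply[OF B] compatibility_rhs_apply[OF B],
          rule arg_cong2[where f = "(=)"];
          simp add: evaluate_components bilinear_map_zero[OF True] bilinear_map_minus[OF True] tens_apply[OF True] True)
  qed (simp add: evaluate_outside)
qed

lemma TLB3_iff: "TLB3 \<longleftrightarrow> (\<forall>a b \<beta>. bilinear_form sA sA \<beta> \<longrightarrow>
    cobracketE (bracketE (a, 0) (b, 0)) (\<lambda>u v. \<beta> (fst u) (fst v)) =
    compatibility_rhs (a, 0) (b, 0) (\<lambda>u v. \<beta> (fst u) (fst v)))"
  unfolding TLB3_def fun_eq_iff
proof (intro iff_allI, goal_cases)
  case (1 a b \<beta>)
  show ?case
  proof (cases "bilinear_form sA sA \<beta>")
    case True
    note B = pulled_back_forms(1)[OF True]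
    show ?thesis
      by (simp only: True simp_thms cobracketE_apply[OF B] compatibility_rhs_apply[OF B],
          rule arg_cong2[where f = "(=)"];
          simp add: evaluate_components bilinear_map_zero[OF True] bilinear_map_minus[OF True] tens_apply[OF True] True)
  qed (simp add: evaluate_outside)
qed

lemma TLB4_iff: "TLB4 \<longleftrightarrow> (\<forall>x y \<beta>. bilinear_form sH sH \<beta> \<longrightarrow>
    cobracketE (bracketE (0, x) (0, y)) (\<lambda>u v. \<beta> (snd u) (snd v)) =
    compatibility_rhs (0, x) (0, y) (\<lambda>u v. \<beta> (snd u) (snd v)))"
  unfolding TLB4_def fun_eq_iff
proof (intro iff_allI, goal_cases)
  case (1 x y \<beta>)
  show ?case
  proof (cases "bilinear_form sH sH \<beta>")
    case True
    note B = pulled_back_forms(3)[OF True]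
    show ?thesis
      by (simp only: True simp_thms cobracketE_apply[OF B] compatibility_rhs_apply[OF B],
          rule arg_cong2[where f = "(=)"];
          simp add: evaluate_components bilinear_map_zero[OF True] bilinear_map_minus[OF True] tens_apply[OF True] True)
  qed (simp add: evaluate_outside)
qed

lemma TYD_iff: "TYD \<longleftrightarrow> (\<forall>a x \<beta>. bilinear_form sH sA \<beta> \<longrightarrow>
    cobracketE (bracketE (0, x) (a, 0)) (\<lambda>u v. \<beta> (snd u) (fst v)) =
    compatibility_rhs (0, x) (a, 0) (\<lambda>u v. \<beta> (snd u) (fst v)))"
  unfolding TYD_def fun_eq_iff
proof (intro iff_allI, goal_cases)
  case (1 a x \<beta>)
  show ?case
  proof (cases "bilinear_form sH sA \<beta>")
    case True
    note B = pulled_back_forms(2)[OF True]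
    show ?thesis
      by (simp only: True simp_thms cobracketE_apply[OF B] compatibility_rhs_apply[OF B],
          rule arg_cong2[where f = "(=)"];
          simp add: evaluate_components bilinear_map_zero[OF True] bilinear_map_minus[OF True] tens_apply[OF True] True)
  qed (simp add: evaluate_outside)
qed

section \<open>Reduction of the compatibility condition to components and to argument types\<close>

context
  assumes anti_bracketE: "antisymmetric bracketE" and anti_cobracketE: "co_antisymmetric cobracketE"
begin

lemma cobracketE_swap: "cobracketE u F = - cobracketE u (\<lambda>u v. F v u)"
  by (rule co_antisymmetric_apply[OF anti_cobracketE])

text \<open>The minus sign is spelled \<open>fun_scale (-1)\<close> to fit the closure rules of
  \<open>tensor_functional\<close>.\<close>

lemma compatibility_rhs_eq:
  "compatibility_rhs u v = bracket_left scaleE alphaE bracketE (alphaE u) (cobracketE v)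
    + fun_scale (-1) (bracket_left scaleE alphaE bracketE (alphaE v) (cobracketE u))"
  by (simp add: compatibility_rhs_def bracket_right_eq_bracket_left[OF functional_cobracketE anti_bracketE]
      fun_scale_def fun_eq_iff)

lemma compatE_iff:
  "compatE u v \<longleftrightarrow>
    (\<forall>\<beta>. bilinear_form sA sA \<beta> \<longrightarrow> cobracketE (bracketE u v) (\<lambda>u v. \<beta> (fst u) (fst v))
      = compatibility_rhs u v (\<lambda>u v. \<beta> (fst u) (fst v))) \<and>
    (\<forall>\<beta>. bilinear_form sH sA \<beta> \<longrightarrow> cobracketE (bracketE u v) (\<lambda>u v. \<beta> (snd u) (fst v))
      = compatibility_rhs u v (\<lambda>u v. \<beta> (snd u) (fst v))) \<and>
    (\<forall>\<beta>. bilinear_form sH sH \<beta> \<longrightarrow> cobracketE (bracketE u v) (\<lambda>u v. \<beta> (snd u) (snd v))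
      = compatibility_rhs u v (\<lambda>u v. \<beta> (snd u) (snd v)))"
proof -
  note left = bracket_left_functional[OF hom_vector_space_E bilinear_bracketE functional_cobracketE]
    bracket_left_swap[OF hom_vector_space_E bilinear_bracketE functional_cobracketE cobracketE_swap]
  have "tensor_functional scaleE scaleE (compatibility_rhs u v)"
    unfolding compatibility_rhs_eq by (intro tensor_functional_add tensor_functional_scale left(1))
  moreover have "compatibility_rhs u v (\<lambda>u v. B v u) = - compatibility_rhs u v B" if "bilinear_form scaleE scaleE B" for B
    by (simp add: compatibility_rhs_eq left(2)[OF that] fun_scale_def)
  moreover have "cobracketE w (\<lambda>u v. B v u) = - cobracketE w B" for w B
    using cobracketE_swap[of w B] by simp
  ultimately show ?thesis
    unfolding compatible_def compatibility_rhs_def[symmetric]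
    by (intro tensorE_eq_iff functional_cobracketE)
qed

lemma compatE_all_iff:
  "(\<forall>u v. compatE u v) \<longleftrightarrow>
    (\<forall>a b. compatE (a, 0) (b, 0)) \<and> (\<forall>a x. compatE (0, x) (a, 0)) \<and> (\<forall>x y. compatE (0, x) (0, y))"
proof (intro iffI conjI allI; (elim conjE)?)
  fix u v
  assume AA: "\<forall>a b. compatE (a, 0) (b, 0)" and HA: "\<forall>a x. compatE (0, x) (a, 0)"
    and HH: "\<forall>x y. compatE (0, x) (0, y)"
  note add = compatible_add[OF hom_vector_space_E bilinear_bracketE anti_bracketE linear_cobracketE]
    and sym = compatible_sym[OF hom_vector_space_E bilinear_bracketE anti_bracketE linear_cobracketE]
  \<comment> \<open>The first argument is split while the second lies in one summand; the type with
    \<open>A\<close> first and \<open>H\<close> second comes from the assumption \<open>HA\<close>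
    by symmetry.\<close>
  have A: "compatE u (a, 0)" and H: "compatE u (0, x)" for a x
    using add[of "(fst u, 0)" "(a, 0)" "(0, snd u)"] add[of "(fst u, 0)" "(0, x)" "(0, snd u)"]
      AA HA HH sym[of "(0, x)" "(fst u, 0)"] by simp_all
  \<comment> \<open>Symmetry moves the second argument to the front, additivity joins its two parts,
    and symmetry restores the order.\<close>
  show "compatE u v"
    using sym[OF add[OF sym[OF A] sym[OF H], of "fst v" "snd v"]] by simp
qed blast+

end

lemma hom_lie_bialgebra_E_iff:
  assumes "cocycle_cross_product_system" "cycle_cross_coproduct_system"
  shows "hom_lie_bialgebra scaleE alphaE bracketE cobracketE \<longleftrightarrow>
    TBB5 \<and> TBB6 \<and> TBB7 \<and> TBB8 \<and> TLB1 \<and> TLB2 \<and> TLB3 \<and> TLB4 \<and> TYD"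
proof -
  have algebra: "hom_lie_algebra scaleE alphaE bracketE" and coalgebra: "hom_lie_coalgebra scaleE alphaE cobracketE"
    using assms by (simp_all add: hom_lie_algebra_E hom_lie_coalgebra_E)
  then have anti: "antisymmetric bracketE" "co_antisymmetric cobracketE"
    by (simp_all add: hom_lie_algebra_def hom_lie_coalgebra_def)
  have "hom_lie_bialgebra scaleE alphaE bracketE cobracketE \<longleftrightarrow> (\<forall>u v. compatE u v)"
    using algebra coalgebra by (simp add: hom_lie_bialgebra_def compatible_def)
  also note compatE_all_iff[OF anti]
  also have "(\<forall>a b. compatE (a, 0) (b, 0)) \<and> (\<forall>a x. compatE (0, x) (a, 0)) \<and> (\<forall>x y. compatE (0, x) (0, y)) \<longleftrightarrow>
      TBB5 \<and> TBB6 \<and> TBB7 \<and> TBB8 \<and> TLB1 \<and> TLB2 \<and> TLB3 \<and> TLB4 \<and> TYD"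
    \<comment> \<open>Both sides become conjunctions of the same nine quantified statements, grouped
      by argument type on the left and by equation on the right.\<close>
    unfolding compatE_iff[OF anti] TBB5_iff TBB6_iff TBB7_iff TBB8_iff
      TLB1_iff TLB2_iff TLB3_iff TLB4_iff TYD_iff
    by meson
  finally show ?thesis .
qed

end

theorem theorem4p4:
  fixes D :: "('k::alg_closed_field, 'a::ab_group_add, 'h::ab_group_add) hom_datum"
  assumes "CHAR('k) \<noteq> 2" and "CHAR('k) \<noteq> 3"
    and "hom_pair D"
    and "hom_datum.cocycle_cross_product_system D"
    and "hom_datum.cycle_cross_coproduct_system D"
  shows "hom_lie_bialgebra (hom_datum.scaleE D) (hom_datum.alphaE D)
           (hom_datum.bracketE D) (hom_datum.cobracketE D) \<longleftrightarrow>
         hom_datum.TBB5 D \<and> hom_datum.TBB6 D \<and> hom_datum.TBB7 D \<and> hom_datum.TBB8 D \<and>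
         hom_datum.TLB1 D \<and> hom_datum.TLB2 D \<and> hom_datum.TLB3 D \<and> hom_datum.TLB4 D \<and>
         hom_datum.TYD D"
  using assms(3,4,5) by (rule hom_pair.hom_lie_bialgebra_E_iff)

end
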